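(* Let $\alpha_1,\alpha_2,\alpha_3\in(0,1]$, let $A=(a_{ij})\in\mathbb{R}^{3\times 3}$, and let $$Q(s)=\det\left(\operatorname{diag}(s^{\alpha_1},s^{\alpha_2},s^{\alpha_3})-A\right)$$ be the characteristic function of the homogeneous system $$D^{\alpha_i}x_i(t)=\sum_{j=1}^3 a_{ij}x_j(t),\qquad i=1,2,3. \quad (\ast)$$ (a) If $\det A>0$, then the system $(\ast)$ is unstable. (b) If $\det A<0$, $\alpha_1+\alpha_2+\alpha_3\ge 2$, and $Q$ is of the form $$Q(s)=s^{\alpha_1+\alpha_2+\alpha_3}-\sum_{k=1}^n c_k s^{\psi_k}-\det A$$ with some $n\in\mathbb{N}$, real numbers $c_1,\dots,c_n$ satisfying $\max_k c_k>\min_k c_k\ge 0$, and exponents $\psi_k\in(0,2)$ for $k=1,\dots,n$, then the system $(\ast)$ is unstable.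
   Context: $D^{\alpha}$ denotes the Caputo fractional derivative of order $\alpha\in(0,1]$ with starting point $0$: for $\alpha\in(0,1)$, $D^\alpha x(t)=\frac{1}{\Gamma(1-\alpha)}\int_0^t (t-\tau)^{-\alpha}x'(\tau)\,d\tau$ for absolutely continuous $x$ (in general, $D^\alpha x=\frac{d}{dt}J^{1-\alpha}(x-x(0))$ with $J^{1-\alpha}$ the Riemann-Liouville integral of order $1-\alpha$), and $D^1x=x'$. The system is considered for $t>0$ with initial values $x_i(0)=x_i^0\in\mathbb{R}$. Complex powers are taken with the principal branch: $s^\beta=|s|^\beta e^{\mathrm{i}\beta\arg s}$ with $\arg s\in(-\pi,\pi]$ for $s\neq 0$, and $0^\beta=0$ for $\beta>0$. The homogeneous linear system is called stable if its zero solution is stable in the sense of Lyapunov (for every $\varepsilon>0$ there is $\delta>0$ such that $\|x^0\|<\delta$ implies $\|x(t)\|<\varepsilon$ for all $t\ge0$), and unstable if it is not stable. *)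

theory Defs
  imports "HOL-Analysis.Analysis"
begin

text \<open>
  Riemann--Liouville integral with starting point 0. The order 0, where \<open>J\<close> is the identity,
  is a separate case because \<open>Gamma 0 = 0\<close> in the library. At \<open>\<tau> = t\<close> the kernel has the
  value \<open>0 powr (\<beta> - 1) = 0\<close>, which does not affect the integral. For \<open>f\<close> continuous on
  \<open>{0..t}\<close> and \<open>\<beta> > 0\<close> the integrand is absolutely integrable, so the Henstock--Kurzweil
  integral used here is the Lebesgue integral.
\<close>

definition RL_integral :: "real \<Rightarrow> (real \<Rightarrow> real) \<Rightarrow> real \<Rightarrow> real" where
  "RL_integral \<beta> f t =
     (if \<beta> = 0 then f t
      else 1 / Gamma \<beta> * integral {0..t} (\<lambda>\<tau>. (t - \<tau>) powr (\<beta> - 1) * f \<tau>))"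

text \<open>
  \<open>has_caputo_derivative \<alpha> x d t\<close>: the Caputo derivative of order \<open>\<alpha>\<close> of \<open>x\<close>, that is, the
  derivative of \<open>J\<^bsup>1-\<alpha>\<^esup> (x - x 0)\<close>, exists at \<open>t > 0\<close> and equals \<open>d\<close>. For \<open>\<alpha> = 1\<close> this is
  the ordinary derivative.
\<close>

definition has_caputo_derivative :: "real \<Rightarrow> (real \<Rightarrow> real) \<Rightarrow> real \<Rightarrow> real \<Rightarrow> bool" where
  "has_caputo_derivative \<alpha> x d t \<longleftrightarrow>
     (RL_integral (1 - \<alpha>) (\<lambda>\<tau>. x \<tau> - x 0) has_real_derivative d) (at t)"

text \<open>
  Only the values of \<open>x\<close> on \<open>{0..}\<close> matter. Continuity at 0 is what ties the solution to its
  initial value \<open>x 0\<close>, since the equation is only imposed for \<open>t > 0\<close>.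
\<close>

definition caputo_solution ::
    "real ^ 'n \<Rightarrow> real ^ 'n ^ 'n \<Rightarrow> (real \<Rightarrow> real ^ 'n) \<Rightarrow> bool" where
  "caputo_solution \<alpha> A x \<longleftrightarrow>
     continuous_on {0..} x \<and>
     (\<forall>t>0. \<forall>i. has_caputo_derivative (\<alpha> $ i) (\<lambda>\<tau>. x \<tau> $ i) (\<Sum>j\<in>UNIV. A $ i $ j * x t $ j) t)"

definition caputo_stable :: "real ^ 'n \<Rightarrow> real ^ 'n ^ 'n \<Rightarrow> bool" where
  "caputo_stable \<alpha> A \<longleftrightarrow>
     (\<forall>\<epsilon>>0. \<exists>\<delta>>0. \<forall>x. caputo_solution \<alpha> A x \<and> norm (x 0) < \<delta> \<longrightarrow> (\<forall>t\<ge>0. norm (x t) < \<epsilon>))"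

definition caputo_unstable :: "real ^ 'n \<Rightarrow> real ^ 'n ^ 'n \<Rightarrow> bool" where
  "caputo_unstable \<alpha> A \<longleftrightarrow> \<not> caputo_stable \<alpha> A"

text \<open>
  Complex \<open>powr\<close> is the principal branch with argument in \<open>(-\<pi>, \<pi>]\<close>, and \<open>0 powr z = 0\<close>.
\<close>

definition caputo_charfun :: "real ^ 'n \<Rightarrow> real ^ 'n ^ 'n \<Rightarrow> complex \<Rightarrow> complex" where
  "caputo_charfun \<alpha> A s =
     det (\<chi> i j. (if i = j then s powr of_real (\<alpha> $ i) else 0) - of_real (A $ i $ j))"

end

theory Submission
  imports Defs "HOL-Complex_Analysis.Conformal_Mappings"
begin

text \<open>
  If the system is stable, then by linearity the solutions with initial values proportional to the
  unit vectors are bounded, so their Laplace transforms exist for \<open>Re s > 0\<close> and form a matrix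
  \<open>X s\<close> with \<open>(diag (s powr \<alpha>) - A) ** X s\<close> a diagonal matrix without zeros on the diagonal. Hence
  the characteristic function has no zero with \<open>Re s > 0\<close>. Such a zero exists in both cases: on the
  positive real axis by the intermediate value theorem in case (a), and in the open right half-plane
  by following the argument of \<open>Q\<close> around a large quarter disc in case (b).
\<close>

section \<open>Riemann--Liouville integrals as convolutions\<close>

text \<open>Stability only constrains solutions that exist, so genuine solutions must be produced.
  In the Caputo equation the integral sits inside a derivative, which is awkward for a fixed point
  argument. The construction therefore solves x = x0 + J^\<alpha> (A x), and the Caputo equation
  follows by applying J^(1-\<alpha>) and differentiating.

  Everything about J^\<beta> rests on one fact: it is convolution with a kernel whose Laplace
  transform is s^(-\<beta>). The same fact supplies the contraction constant of the fixed point
  argument and the factor s^\<alpha> of the transformed system. The kernel is cut off at u \<le> 0,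
  so that convolutions run over the whole line and affine substitutions need no bookkeeping of
  limits.\<close>

definition rl_kernel :: "real \<Rightarrow> real \<Rightarrow> real" where
  "rl_kernel \<beta> u = (if u > 0 then u powr (\<beta> - 1) / Gamma \<beta> else 0)"

lemma rl_kernel_measurable [measurable]: "rl_kernel \<beta> \<in> borel_measurable borel"
  unfolding rl_kernel_def[abs_def] by measurable

lemma rl_kernel_nonneg: "\<beta> > 0 \<Longrightarrow> rl_kernel \<beta> u \<ge> 0"
  by (simp add: rl_kernel_def Gamma_real_pos)

text \<open>Euler's integral for \<Gamma>(\<beta>) under the scaling u -> s u: the kernel is
  homogeneous of degree \<beta> - 1, and the Jacobian supplies the remaining factor 1 / s.\<close>

lemma rl_kernel_laplace:
  assumes b: "\<beta> > 0" and s: "s > 0"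
  shows "has_bochner_integral lborel (\<lambda>u. exp (- s * u) * rl_kernel \<beta> u) (s powr (- \<beta>))"
proof -
  have G: "Gamma \<beta> > 0" using b by (rule Gamma_real_pos)
  have "has_bochner_integral lborel (\<lambda>t. indicator {0..} t * t powr (\<beta> - 1) / exp t) (Gamma \<beta>)"
    by (rule has_bochner_integral_nn_integral)
       (use G in \<open>auto simp: Gamma_conv_nn_integral_real[OF b, symmetric]\<close>)
  then have "has_bochner_integral lborel
      (\<lambda>t. indicator {0..} t * t powr (\<beta> - 1) / exp t / Gamma \<beta>) (Gamma \<beta> / Gamma \<beta>)"
    by (rule has_bochner_integral_divide_zero)
  moreover have "(\<lambda>t. indicator {0..} t * t powr (\<beta> - 1) / exp t / Gamma \<beta>)
      = (\<lambda>u. exp (- u) * rl_kernel \<beta> u)"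
    by (auto simp: rl_kernel_def fun_eq_iff indicator_def exp_minus field_simps)
  ultimately have "has_bochner_integral lborel (\<lambda>u. exp (- u) * rl_kernel \<beta> u) 1"
    using G by simp
  then have "has_bochner_integral lborel
      (\<lambda>x. exp (- (0 + s * x)) * rl_kernel \<beta> (0 + s * x)) (1 /\<^sub>R \<bar>s\<bar>)"
    using s by (subst (asm) lborel_has_bochner_integral_real_affine_iff[of s _ _ 0]) auto
  then have "has_bochner_integral lborel
      (\<lambda>x. exp (- (0 + s * x)) * rl_kernel \<beta> (0 + s * x) * s powr (1 - \<beta>)) ((1 /\<^sub>R \<bar>s\<bar>) * s powr (1 - \<beta>))"
    by (rule has_bochner_integral_mult_left)
  moreover have "(\<lambda>x. exp (- (0 + s * x)) * rl_kernel \<beta> (0 + s * x) * s powr (1 - \<beta>))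
      = (\<lambda>u. exp (- s * u) * rl_kernel \<beta> u)"
    using s by (auto simp: fun_eq_iff rl_kernel_def powr_mult powr_diff zero_less_mult_iff field_simps)
  moreover have "(1 /\<^sub>R \<bar>s\<bar>) * s powr (1 - \<beta>) = s powr (- \<beta>)"
    using s by (simp add: powr_diff powr_minus field_simps)
  ultimately show ?thesis
    by simp
qed

text \<open>The semigroup law for the orders a and 1 - a. The substitution v = w + (t - w) x
  produces the integral for Beta(a, 1 - a), the powers of t - w cancel against the Jacobian, and
  Beta(a, 1 - a) = \<Gamma>(a) \<Gamma>(1 - a) because \<Gamma>(1) = 1.\<close>

lemma rl_kernel_compose:
  assumes a: "0 < a" "a < 1" and wt: "w < t"
  shows "has_bochner_integral lborel (\<lambda>v. rl_kernel (1 - a) (t - v) * rl_kernel a (v - w)) 1"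
proof -
  have G: "Gamma a > 0" "Gamma (1 - a) > 0" using a by (auto intro: Gamma_real_pos)
  define f where "f x = indicator {0..1} x * (x powr (a - 1) * (1 - x) powr (1 - a - 1))" for x :: real
  have "((\<lambda>x. if x \<in> {0..1} then x powr (a - 1) * (1 - x) powr (1 - a - 1) else 0)
      has_integral Beta a (1 - a)) UNIV"
    using has_integral_Beta_real[of a "1 - a"] a by (subst has_integral_restrict_UNIV) auto
  then have I: "(f has_integral Beta a (1 - a)) UNIV"
    by (rule has_integral_eq[rotated]) (auto simp: f_def)
  have B: "Beta a (1 - a) = Gamma a * Gamma (1 - a)"
    by (simp add: Beta_def)
  have m: "f \<in> borel_measurable borel"
    unfolding f_def[abs_def] by measurable
  have "has_bochner_integral lborel f (Beta a (1 - a))"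
    using nn_integral_has_integral_lborel[OF m _ I] m G B
    by (intro has_bochner_integral_nn_integral) (auto simp: f_def)
  then have "has_bochner_integral lborel (\<lambda>x. f x / (Gamma a * Gamma (1 - a)))
      (Beta a (1 - a) / (Gamma a * Gamma (1 - a)))"
    by (rule has_bochner_integral_divide_zero)
  then have 1: "has_bochner_integral lborel (\<lambda>x. f x / (Gamma a * Gamma (1 - a))) 1"
    using G B by simp
  have eq: "rl_kernel (1 - a) (t - (w + (t - w) * x)) * rl_kernel a (w + (t - w) * x - w)
      = (1 / (t - w)) * (f x / (Gamma a * Gamma (1 - a)))" for x
  proof -
    have t1: "t - (w + (t - w) * x) = (t - w) * (1 - x)" by (simp add: algebra_simps)
    have pos: "(t - w) * y > 0 \<longleftrightarrow> y > 0" for y using wt by (simp add: zero_less_mult_iff)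
    have p: "(t - w) powr (a - 1) * (t - w) powr (- a) = 1 / (t - w)"
      using wt by (simp add: powr_diff powr_minus field_simps)
    show ?thesis
    proof (cases "0 < x \<and> x < 1")
      case True
      then have "rl_kernel (1 - a) (t - (w + (t - w) * x)) * rl_kernel a (w + (t - w) * x - w)
        = ((t - w) powr (a - 1) * (t - w) powr (- a)) * (f x / (Gamma a * Gamma (1 - a)))"
        unfolding rl_kernel_def t1 using wt by (simp add: pos powr_mult f_def mult_ac)
      then show ?thesis unfolding p .
    next
      case False
      then show ?thesis
        unfolding rl_kernel_def t1 using wt by (auto simp: pos f_def indicator_def)
    qed
  qed
  have "has_bochner_integral lborel (\<lambda>x. (1 / (t - w)) * (f x / (Gamma a * Gamma (1 - a)))) ((1 / (t - w)) * 1)"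
    by (rule has_bochner_integral_mult_right) (use 1 in auto)
  then have "has_bochner_integral lborel
      (\<lambda>x. rl_kernel (1 - a) (t - (w + (t - w) * x)) * rl_kernel a (w + (t - w) * x - w)) (1 /\<^sub>R \<bar>t - w\<bar>)"
    unfolding eq using wt by (simp add: divide_inverse)
  then show ?thesis
    using wt by (subst lborel_has_bochner_integral_real_affine_iff[of "t - w" _ _ w]) auto
qed

lemma continuous_on_halfline_measurable:
  fixes f :: "real \<Rightarrow> real"
  assumes "continuous_on {0..} f"
  shows "(\<lambda>t. indicator {0..} t * f t) \<in> borel_measurable borel"
  using borel_measurable_continuous_on_indicator[OF _ assms] by simp

lemma rl_kernel_convolution_integrable:
  assumes b: "\<beta> > 0" and f: "continuous_on {0..} f"
  shows "integrable lborel (\<lambda>u. rl_kernel \<beta> (t - u) * (indicator {0..} u * f u))"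
proof -
  have "compact (f ` {0..t})"
    by (rule compact_continuous_image) (auto intro: continuous_on_subset[OF f])
  then obtain M where M: "\<And>u. u \<in> {0..t} \<Longrightarrow> \<bar>f u\<bar> \<le> M"
    by (metis bounded_iff compact_imp_bounded image_eqI real_norm_def)
  \<comment> \<open>The kernel alone is not integrable at infinity, so the majorant is taken with an
    exponential weight. On {0..t} this costs nothing, since exp t * exp (- (t - u)) = exp u \<ge>
    1.\<close>
  have "integrable lborel (\<lambda>u. exp (- 1 * u) * rl_kernel \<beta> u)"
    using rl_kernel_laplace[OF b, of 1] by (auto simp: has_bochner_integral_iff)
  from lborel_integrable_real_affine[OF this, of "-1" t]
  have "integrable lborel (\<lambda>u. exp t * M * (exp (- 1 * (t - u)) * rl_kernel \<beta> (t - u)))"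
    by (intro integrable_mult_right) simp
  then show ?thesis
  proof (rule Bochner_Integration.integrable_bound)
    show "(\<lambda>u. rl_kernel \<beta> (t - u) * (indicator {0..} u * f u)) \<in> borel_measurable lborel"
      using continuous_on_halfline_measurable[OF f] by measurable
    show "AE u in lborel. norm (rl_kernel \<beta> (t - u) * (indicator {0..} u * f u))
        \<le> norm (exp t * M * (exp (- 1 * (t - u)) * rl_kernel \<beta> (t - u)))"
    proof (rule AE_I2)
      fix u
      show "norm (rl_kernel \<beta> (t - u) * (indicator {0..} u * f u))
        \<le> norm (exp t * M * (exp (- 1 * (t - u)) * rl_kernel \<beta> (t - u)))"
      proof (cases "u \<in> {0..t}")
        case True
        have "\<bar>f u\<bar> \<le> \<bar>M\<bar>" using M[OF True] by simp
        also have "\<dots> \<le> \<bar>M\<bar> * exp u" using True by (simp add: mult_le_cancel_left1)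
        finally have "\<bar>f u\<bar> * rl_kernel \<beta> (t - u) \<le> \<bar>M\<bar> * exp u * rl_kernel \<beta> (t - u)"
          by (rule mult_right_mono) (rule rl_kernel_nonneg[OF b])
        then show ?thesis using True
          by (simp add: abs_mult rl_kernel_nonneg[OF b] exp_diff field_simps)
      next
        case False
        then show ?thesis by (auto simp: rl_kernel_def indicator_def)
      qed
    qed
  qed
qed

lemma RL_integral_eq_convolution:
  assumes b: "\<beta> > 0" and f: "continuous_on {0..} f"
  shows "RL_integral \<beta> f t = (\<integral>u. rl_kernel \<beta> (t - u) * (indicator {0..} u * f u) \<partial>lborel)"
proof -
  have "(\<integral>u. rl_kernel \<beta> (t - u) * (indicator {0..} u * f u) \<partial>lborel)
      = integral UNIV (\<lambda>u. rl_kernel \<beta> (t - u) * (indicator {0..} u * f u))"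
    by (rule integral_lborel[symmetric]) (rule rl_kernel_convolution_integrable[OF assms])
  also have "\<dots> = integral UNIV (\<lambda>u. if u \<in> {0..t} then (1 / Gamma \<beta>) * ((t - u) powr (\<beta> - 1) * f u) else 0)"
    by (rule integral_cong) (auto simp: rl_kernel_def indicator_def)
  also have "\<dots> = integral {0..t} (\<lambda>u. (1 / Gamma \<beta>) * ((t - u) powr (\<beta> - 1) * f u))"
    by (rule integral_restrict_UNIV)
  finally show ?thesis
    using b by (simp add: RL_integral_def)
qed

text \<open>By Fubini the integration over \<open>v\<close> acts on the two kernels alone, and their
  composition is 1 for w < t and 0 otherwise. This identity J^(1-a) J^a = J^1 turns the Volterra
  equation into the Caputo equation.\<close>

lemma RL_integral_compose:
  assumes a: "0 < a" "a < 1" and f: "continuous_on {0..} f" and g: "continuous_on {0..} (RL_integral a f)"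
    and t: "0 \<le> t"
  shows "RL_integral (1 - a) (RL_integral a f) t = integral {0..t} f"
proof -
  define f0 where "f0 u = indicator {0..} u * f u" for u
  have m[measurable]: "f0 \<in> borel_measurable borel"
    unfolding f0_def[abs_def] by (rule continuous_on_halfline_measurable[OF f])
  define F where "F w v = rl_kernel (1 - a) (t - v) * rl_kernel a (v - w) * f0 w" for w v
  have kint: "integrable lborel (\<lambda>v. rl_kernel (1 - a) (t - v) * rl_kernel a (v - w))"
    and kval: "(\<integral>v. rl_kernel (1 - a) (t - v) * rl_kernel a (v - w) \<partial>lborel) = indicator {..<t} w" for w
  proof -
    have *: "\<not> w < t \<Longrightarrow> (\<lambda>v. rl_kernel (1 - a) (t - v) * rl_kernel a (v - w)) = (\<lambda>v. 0)"
      by (auto simp: rl_kernel_def fun_eq_iff)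
    show "integrable lborel (\<lambda>v. rl_kernel (1 - a) (t - v) * rl_kernel a (v - w))"
      using rl_kernel_compose[OF a, of w t] * by (cases "w < t") (auto simp: has_bochner_integral_iff)
    show "(\<integral>v. rl_kernel (1 - a) (t - v) * rl_kernel a (v - w) \<partial>lborel) = indicator {..<t} w"
      using rl_kernel_compose[OF a, of w t] * by (cases "w < t") (auto simp: has_bochner_integral_iff)
  qed
  have fint: "integrable lborel (\<lambda>w. indicator {..<t} w * f0 w)"
  proof -
    have "set_integrable lborel {0..t} f"
      by (rule borel_integrable_atLeastAtMost') (auto intro: continuous_on_subset[OF f])
    then have "integrable lborel (\<lambda>w. indicator {0..t} w *\<^sub>R f w)"
      by (simp add: set_integrable_def)
    then show ?thesis
    proof (rule Bochner_Integration.integrable_bound)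
      show "AE w in lborel. norm (indicator {..<t} w * f0 w) \<le> norm (indicator {0..t} w *\<^sub>R f w)"
        by (rule AE_I2) (auto simp: f0_def indicator_def)
    qed measurable
  qed
  have Fint: "integrable (lborel \<Otimes>\<^sub>M lborel) (case_prod F)"
  proof (rule lborel_pair.Fubini_integrable)
    show "case_prod F \<in> borel_measurable (lborel \<Otimes>\<^sub>M lborel)"
      unfolding F_def by measurable
    have "(\<integral>v. norm (case (w, v) of (w, v) \<Rightarrow> F w v) \<partial>lborel) = norm (indicator {..<t} w * f0 w)" for w
      using a by (simp add: F_def abs_mult rl_kernel_nonneg kval)
    then show "integrable lborel (\<lambda>w. \<integral>v. norm (case (w, v) of (w, v) \<Rightarrow> F w v) \<partial>lborel)"
      using integrable_norm[OF fint] by simp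
    show "AE w in lborel. integrable lborel (\<lambda>v. case (w, v) of (w, v) \<Rightarrow> F w v)"
      by (rule AE_I2) (simp add: F_def kint)
  qed
  have inner: "(\<integral>w. F w v \<partial>lborel) = rl_kernel (1 - a) (t - v) * (indicator {0..} v * RL_integral a f v)" for v
  proof (cases "v \<ge> 0")
    case True
    have "(\<integral>w. F w v \<partial>lborel) = rl_kernel (1 - a) (t - v) * (\<integral>w. rl_kernel a (v - w) * f0 w \<partial>lborel)"
      unfolding F_def by (simp add: mult.assoc)
    then show ?thesis
      using True RL_integral_eq_convolution[OF a(1) f] by (simp add: f0_def)
  next
    case False
    then have "F w v = 0" for w by (auto simp: F_def f0_def rl_kernel_def indicator_def)
    then show ?thesis using False by simp
  qed
  have "RL_integral (1 - a) (RL_integral a f) t = (\<integral>v. (\<integral>w. F w v \<partial>lborel) \<partial>lborel)"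
    unfolding inner using a by (intro RL_integral_eq_convolution g) simp
  also have "\<dots> = (\<integral>w. (\<integral>v. F w v \<partial>lborel) \<partial>lborel)"
    by (rule lborel_pair.Fubini_integral[OF Fint])
  also have "\<dots> = (\<integral>w. indicator {..<t} w * f0 w \<partial>lborel)"
    by (simp add: F_def kval)
  also have "\<dots> = integral UNIV (\<lambda>w. indicator {..<t} w * f0 w)"
    by (rule integral_lborel[symmetric, OF fint])
  also have "\<dots> = integral UNIV (\<lambda>w. if w \<in> {0..t} then f w else 0)"
    by (rule integral_spike[of "{t}"]) (auto simp: f0_def indicator_def)
  also have "\<dots> = integral {0..t} f"
    by (rule integral_restrict_UNIV)
  finally show ?thesis .
qed

text \<open>Reflected form of the convolution: the singular kernel no longer depends on
  \<open>t\<close>, which enters only through \<open>f\<close> and a cutoff. Estimates and limits in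
  \<open>t\<close> use this form.\<close>

lemma has_bochner_integral_RL_integral:
  assumes b: "\<beta> > 0" and f: "continuous_on {0..} f"
  shows "has_bochner_integral lborel (\<lambda>u. rl_kernel \<beta> u * (indicator {..t} u * f (t - u))) (RL_integral \<beta> f t)"
proof -
  have "has_bochner_integral lborel (\<lambda>u. rl_kernel \<beta> (t - u) * (indicator {0..} u * f u)) (RL_integral \<beta> f t)"
    using rl_kernel_convolution_integrable[OF assms] RL_integral_eq_convolution[OF assms]
    by (simp add: has_bochner_integral_iff)
  then show ?thesis
    by (subst (asm) lborel_has_bochner_integral_real_affine_iff[of "-1" _ _ t])
       (auto simp: indicator_def cong: if_cong)
qed

section \<open>Linearity, exponential bounds and continuity of J^\<beta>\<close>

lemma RL_integral_cong:
  assumes "\<And>\<tau>. 0 \<le> \<tau> \<Longrightarrow> \<tau> \<le> t \<Longrightarrow> f \<tau> = g \<tau>" "0 \<le> t"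
  shows "RL_integral \<beta> f t = RL_integral \<beta> g t"
proof -
  have "integral {0..t} (\<lambda>\<tau>. (t - \<tau>) powr (\<beta> - 1) * f \<tau>) = integral {0..t} (\<lambda>\<tau>. (t - \<tau>) powr (\<beta> - 1) * g \<tau>)"
    by (rule integral_cong) (use assms in auto)
  then show ?thesis using assms by (simp add: RL_integral_def)
qed

lemma RL_integral_diff:
  assumes "\<beta> > 0" "continuous_on {0..} f" "continuous_on {0..} g"
  shows "RL_integral \<beta> (\<lambda>\<tau>. f \<tau> - g \<tau>) t = RL_integral \<beta> f t - RL_integral \<beta> g t"
proof -
  have "has_bochner_integral lborel (\<lambda>u. rl_kernel \<beta> u * (indicator {..t} u * f (t - u))
      - rl_kernel \<beta> u * (indicator {..t} u * g (t - u))) (RL_integral \<beta> f t - RL_integral \<beta> g t)"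
    by (intro has_bochner_integral_diff has_bochner_integral_RL_integral assms)
  moreover have "has_bochner_integral lborel (\<lambda>u. rl_kernel \<beta> u * (indicator {..t} u * (f (t - u) - g (t - u))))
      (RL_integral \<beta> (\<lambda>\<tau>. f \<tau> - g \<tau>) t)"
    using assms by (intro has_bochner_integral_RL_integral[where f="\<lambda>\<tau>. f \<tau> - g \<tau>"] continuous_intros)
  ultimately show ?thesis
    by (simp add: algebra_simps has_bochner_integral_iff)
qed

text \<open>In the sup norm weighted by exp (- s t), J^\<beta> has norm at most s powr (- \<beta>):
  after splitting exp (s (t - u)) = exp (s t) exp (- s u), what remains is the Laplace transform of
  the kernel. Its smallness for large \<open>s\<close> drives the contraction.\<close>

lemma RL_integral_bound:
  assumes b: "\<beta> > 0" and s: "s > 0" and f: "continuous_on {0..} f"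
    and le: "\<And>t. 0 \<le> t \<Longrightarrow> \<bar>f t\<bar> \<le> M * exp (s * t)"
  shows "\<bar>RL_integral \<beta> f t\<bar> \<le> M * s powr (- \<beta>) * exp (s * t)"
proof -
  have M: "M \<ge> 0" using le[of 0] by simp
  have I: "has_bochner_integral lborel (\<lambda>u. (M * exp (s * t)) * (exp (- s * u) * rl_kernel \<beta> u))
      ((M * exp (s * t)) * s powr (- \<beta>))"
    by (rule has_bochner_integral_mult_right) (rule rl_kernel_laplace[OF b s])
  note R = has_bochner_integral_RL_integral[OF b f, of t]
  have "\<bar>RL_integral \<beta> f t\<bar> = norm (\<integral>u. rl_kernel \<beta> u * (indicator {..t} u * f (t - u)) \<partial>lborel)"
    using R by (simp add: has_bochner_integral_iff)
  also have "\<dots> \<le> (\<integral>u. (M * exp (s * t)) * (exp (- s * u) * rl_kernel \<beta> u) \<partial>lborel)"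
  proof (rule Bochner_Integration.integral_norm_bound_integral)
    show "integrable lborel (\<lambda>u. rl_kernel \<beta> u * (indicator {..t} u * f (t - u)))"
      using R by (simp add: has_bochner_integral_iff)
    show "integrable lborel (\<lambda>u. (M * exp (s * t)) * (exp (- s * u) * rl_kernel \<beta> u))"
      using I unfolding has_bochner_integral_iff by blast
    fix u
    show "norm (rl_kernel \<beta> u * (indicator {..t} u * f (t - u))) \<le> (M * exp (s * t)) * (exp (- s * u) * rl_kernel \<beta> u)"
    proof (cases "u \<le> t")
      case True
      have "\<bar>f (t - u)\<bar> * rl_kernel \<beta> u \<le> (M * exp (s * (t - u))) * rl_kernel \<beta> u"
        using le[of "t - u"] True rl_kernel_nonneg[OF b] by (intro mult_right_mono) auto
      also have "\<dots> = (M * exp (s * t)) * (exp (- s * u) * rl_kernel \<beta> u)"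
        by (simp add: right_diff_distrib exp_diff exp_minus field_simps)
      finally show ?thesis
        using True rl_kernel_nonneg[OF b, of u] by (simp add: abs_mult mult_ac)
    next
      case False
      then show ?thesis using M rl_kernel_nonneg[OF b, of u] by simp
    qed
  qed
  also have "\<dots> = M * s powr (- \<beta>) * exp (s * t)"
    using I unfolding has_bochner_integral_iff by simp
  finally show ?thesis .
qed

text \<open>Dominated convergence in the reflected form along a convergent sequence of times. The
  sequence is bounded by some \<open>T\<close>, and exp T * exp (- u) \<ge> 1 for u \<le> T gives a
  majorant independent of \<open>n\<close>.\<close>

lemma RL_integral_continuous:
  assumes b: "\<beta> > 0" and f: "continuous_on {0..} f"
  shows "continuous_on {0..} (RL_integral \<beta> f)"
  unfolding continuous_on_sequentially
proof (intro allI ballI impI)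
  fix x :: "nat \<Rightarrow> real" and a :: real
  assume a: "a \<in> {0..}" and "(\<forall>n. x n \<in> {0..}) \<and> x \<longlonglongrightarrow> a"
  then have x0: "\<And>n. x n \<ge> 0" and x: "x \<longlonglongrightarrow> a" by auto
  obtain T where T: "\<And>n. x n \<le> T"
    using convergent_imp_Bseq[of x] x unfolding convergent_def Bseq_def
    by (metis abs_le_D1 real_norm_def)
  have aT: "a \<le> T" using x T by (metis LIMSEQ_le_const2)
  have "compact (f ` {0..T})"
    by (rule compact_continuous_image) (auto intro: continuous_on_subset[OF f])
  then obtain M where M: "\<And>u. u \<in> {0..T} \<Longrightarrow> \<bar>f u\<bar> \<le> M"
    by (metis bounded_iff compact_imp_bounded image_eqI real_norm_def)
  have M0: "M \<ge> 0" using M[of a] a aT by auto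
  note R = has_bochner_integral_RL_integral[OF b f]
  note meas = R[THEN integrable.intros, THEN borel_measurable_integrable]
  have "(\<lambda>n. \<integral>u. rl_kernel \<beta> u * (indicator {..x n} u * f (x n - u)) \<partial>lborel)
      \<longlonglongrightarrow> (\<integral>u. rl_kernel \<beta> u * (indicator {..a} u * f (a - u)) \<partial>lborel)"
  proof (rule integral_dominated_convergence[OF meas meas])
    have "has_bochner_integral lborel (\<lambda>u. (M * exp T) * (exp (- 1 * u) * rl_kernel \<beta> u)) ((M * exp T) * 1 powr (- \<beta>))"
      by (rule has_bochner_integral_mult_right) (rule rl_kernel_laplace[OF b], simp)
    then show "integrable lborel (\<lambda>u. (M * exp T) * (exp (- 1 * u) * rl_kernel \<beta> u))"
      unfolding has_bochner_integral_iff by blast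
    show "AE u in lborel. norm (rl_kernel \<beta> u * (indicator {..x n} u * f (x n - u)))
        \<le> (M * exp T) * (exp (- 1 * u) * rl_kernel \<beta> u)" for n
    proof (rule AE_I2)
      fix u
      show "norm (rl_kernel \<beta> u * (indicator {..x n} u * f (x n - u)))
        \<le> (M * exp T) * (exp (- 1 * u) * rl_kernel \<beta> u)"
      proof (cases "0 < u \<and> u \<le> x n")
        case True
        then have "\<bar>f (x n - u)\<bar> \<le> M" using T[of n] by (intro M) auto
        also have "M \<le> M * exp (T - u)" using True T[of n] M0 by (simp add: mult_le_cancel_left1)
        finally have "\<bar>f (x n - u)\<bar> * rl_kernel \<beta> u \<le> M * exp (T - u) * rl_kernel \<beta> u"
          by (rule mult_right_mono) (rule rl_kernel_nonneg[OF b])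
        then show ?thesis
          using True by (simp add: abs_mult rl_kernel_nonneg[OF b] exp_diff exp_minus field_simps)
      next
        case False
        then have "norm (rl_kernel \<beta> u * (indicator {..x n} u * f (x n - u))) = 0"
          by (auto simp: rl_kernel_def)
        then show ?thesis using M0 rl_kernel_nonneg[OF b, of u] by (metis exp_ge_zero mult_nonneg_nonneg)
      qed
    qed
    \<comment> \<open>At u = a the cutoff may oscillate along the sequence; this single point is
      discarded.\<close>
    show "AE u in lborel. (\<lambda>n. rl_kernel \<beta> u * (indicator {..x n} u * f (x n - u)))
        \<longlonglongrightarrow> rl_kernel \<beta> u * (indicator {..a} u * f (a - u))"
      using AE_lborel_singleton[of a]
    proof eventually_elim
      case (elim u)
      consider "u < a" | "u > a" using elim by linarith
      then show ?case
      proof cases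
        case 1
        have "isCont f (a - u)"
          using continuous_on_interior[OF f] 1 by simp
        then have "(\<lambda>n. f (x n - u)) \<longlonglongrightarrow> f (a - u)"
          by (rule isCont_tendsto_compose) (intro tendsto_intros x)
        then have "(\<lambda>n. rl_kernel \<beta> u * f (x n - u)) \<longlonglongrightarrow> rl_kernel \<beta> u * f (a - u)"
          by (intro tendsto_intros)
        moreover have "\<forall>\<^sub>F n in sequentially. rl_kernel \<beta> u * f (x n - u)
            = rl_kernel \<beta> u * (indicator {..x n} u * f (x n - u))"
          using order_tendstoD(1)[OF x 1] by eventually_elim auto
        ultimately have "(\<lambda>n. rl_kernel \<beta> u * (indicator {..x n} u * f (x n - u))) \<longlonglongrightarrow> rl_kernel \<beta> u * f (a - u)"
          by (rule Lim_transform_eventually)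
        then show ?thesis
          using 1 by simp
      next
        case 2
        have "\<forall>\<^sub>F n in sequentially. rl_kernel \<beta> u * (indicator {..x n} u * f (x n - u)) = 0"
          using order_tendstoD(2)[OF x 2] by eventually_elim auto
        then show ?thesis using 2 by (simp add: tendsto_eventually)
      qed
    qed
  qed
  then show "(RL_integral \<beta> f \<circ> x) \<longlonglongrightarrow> RL_integral \<beta> f a"
    using R by (simp add: has_bochner_integral_iff comp_def)
qed

section \<open>Existence of solutions\<close>

text \<open>Provides the weight \<open>s\<close> for which the Volterra operator has Lipschitz
  constant at most 1/2.\<close>

lemma ex_large_powr_sum:
  fixes c \<alpha> :: "'n::finite \<Rightarrow> real"
  assumes "\<And>i. \<alpha> i > 0"
  shows "\<exists>s>0. (\<Sum>i\<in>UNIV. c i * s powr (- \<alpha> i)) < 1/2"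
proof -
  have "((\<lambda>s. \<Sum>i\<in>UNIV. c i * s powr (- \<alpha> i)) \<longlongrightarrow> (\<Sum>i\<in>UNIV. c i * 0)) at_top"
    using assms by (intro tendsto_intros tendsto_neg_powr filterlim_ident) auto
  then have "\<forall>\<^sub>F s in at_top. (\<Sum>i\<in>UNIV. c i * s powr (- \<alpha> i)) < 1/2"
    by (rule order_tendstoD) simp
  then have "\<forall>\<^sub>F s in at_top. s > 0 \<and> (\<Sum>i\<in>UNIV. c i * s powr (- \<alpha> i)) < 1/2"
    using eventually_gt_at_top[of 0] by eventually_elim auto
  then show ?thesis
    using eventually_happens[of _ "at_top :: real filter"] by auto
qed

text \<open>
  Banach's fixed point theorem for \<open>g t = exp (- s * t) *\<^sub>R x t\<close> in the space of bounded continuous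
  functions: the Volterra operator is a contraction for large \<open>s\<close>.
\<close>

lemma ex_Volterra_solution:
  fixes \<alpha> x0 :: "real ^ 'n" and A :: "real ^ 'n ^ 'n"
  assumes \<alpha>: "\<And>i. 0 < \<alpha> $ i"
  obtains x where "continuous_on {0..} x"
    "\<And>t i. 0 \<le> t \<Longrightarrow> x t $ i = x0 $ i + RL_integral (\<alpha> $ i) (\<lambda>\<tau>. \<Sum>j\<in>UNIV. A $ i $ j * x \<tau> $ j) t"
proof -
  define C where "C i = (\<Sum>j\<in>UNIV. \<bar>A $ i $ j\<bar>)" for i
  have C0: "C i \<ge> 0" for i by (simp add: C_def sum_nonneg)
  obtain s where s: "s > 0" and half: "(\<Sum>i\<in>UNIV. C i * s powr (- \<alpha> $ i)) < 1/2"
    using ex_large_powr_sum[of "\<lambda>i. \<alpha> $ i" C] \<alpha> by auto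
  define F where "F g i \<tau> = (\<Sum>j\<in>UNIV. A $ i $ j * (exp (s * \<tau>) * g \<tau> $ j))"
    for g :: "real \<Rightarrow>\<^sub>C (real ^ 'n)" and i \<tau>
  \<comment> \<open>The function space lives on the whole real line while the equation concerns t
    \<ge> 0; clamping the time extends the image of the operator to negative times by its value at
    0.\<close>
  define p where "p t = max 0 t" for t :: real
  define U where "U g t = (\<chi> i. exp (- s * p t) * (x0 $ i + RL_integral (\<alpha> $ i) (F g i) (p t)))" for g t
  have Fcont: "continuous_on S (F g i)" for g i S
    unfolding F_def by (intro continuous_intros continuous_on_apply_bcontfun)
  have bnd: "\<bar>exp (- s * p t) * RL_integral (\<alpha> $ i) f (p t)\<bar> \<le> C i * D * s powr (- \<alpha> $ i)"
    if "continuous_on {0..} f" "\<And>\<tau>. \<bar>f \<tau>\<bar> \<le> C i * D * exp (s * \<tau>)" for f i D t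
  proof -
    have "\<bar>exp (- s * p t) * RL_integral (\<alpha> $ i) f (p t)\<bar>
        \<le> exp (- s * p t) * ((C i * D) * s powr (- \<alpha> $ i) * exp (s * p t))"
      unfolding abs_mult abs_exp_cancel
      by (intro mult_left_mono RL_integral_bound \<alpha> s that) auto
    also have "\<dots> = C i * D * s powr (- \<alpha> $ i)"
      by (simp add: exp_minus field_simps)
    finally show ?thesis .
  qed
  have Fbound: "\<bar>F g i \<tau> - F h i \<tau>\<bar> \<le> C i * dist g h * exp (s * \<tau>)" for g h i \<tau>
  proof -
    have "F g i \<tau> - F h i \<tau> = (\<Sum>j\<in>UNIV. A $ i $ j * (exp (s * \<tau>) * (g \<tau> - h \<tau>) $ j))"
      by (simp add: F_def sum_subtractf[symmetric] right_diff_distrib)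
    also have "\<bar>\<dots>\<bar> \<le> (\<Sum>j\<in>UNIV. \<bar>A $ i $ j\<bar> * (exp (s * \<tau>) * dist g h))"
    proof (rule order_trans[OF sum_abs sum_mono])
      fix j
      have "\<bar>(g \<tau> - h \<tau>) $ j\<bar> \<le> norm (g \<tau> - h \<tau>)" by (rule component_le_norm_cart)
      also have "\<dots> \<le> dist g h" using dist_bounded[of g \<tau> h] by (simp add: dist_norm)
      finally show "\<bar>A $ i $ j * (exp (s * \<tau>) * (g \<tau> - h \<tau>) $ j)\<bar> \<le> \<bar>A $ i $ j\<bar> * (exp (s * \<tau>) * dist g h)"
        by (simp add: abs_mult mult_left_mono)
    qed
    also have "\<dots> = C i * dist g h * exp (s * \<tau>)"
      by (simp add: C_def sum_distrib_left sum_distrib_right mult_ac)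
    finally show ?thesis .
  qed
  have U_diff: "norm (U g t - U h t) \<le> 1/2 * dist g h" for g h t
  proof -
    have "norm (U g t - U h t) \<le> (\<Sum>i\<in>UNIV. \<bar>(U g t - U h t) $ i\<bar>)"
      by (rule norm_le_l1_cart)
    also have "\<dots> \<le> (\<Sum>i\<in>UNIV. C i * dist g h * s powr (- \<alpha> $ i))"
    proof (rule sum_mono)
      fix i
      have "(U g t - U h t) $ i = exp (- s * p t) * RL_integral (\<alpha> $ i) (\<lambda>\<tau>. F g i \<tau> - F h i \<tau>) (p t)"
        using \<alpha> Fcont by (simp add: U_def RL_integral_diff algebra_simps)
      then show "\<bar>(U g t - U h t) $ i\<bar> \<le> C i * dist g h * s powr (- \<alpha> $ i)"
        using bnd[OF continuous_on_diff[OF Fcont Fcont] Fbound] by simp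
    qed
    also have "\<dots> = (\<Sum>i\<in>UNIV. C i * s powr (- \<alpha> $ i)) * dist g h"
      by (subst sum_distrib_right) (simp add: mult_ac)
    also have "\<dots> \<le> 1/2 * dist g h"
      by (intro mult_right_mono less_imp_le[OF half] zero_le_dist)
    finally show ?thesis .
  qed
  have Ucont: "continuous_on UNIV (U g)" for g
  proof -
    have p: "continuous_on UNIV p"
      unfolding p_def by (intro continuous_intros)
    have "continuous_on UNIV (\<lambda>t. RL_integral (\<alpha> $ i) (F g i) (p t))" for i
      by (rule continuous_on_compose2[OF RL_integral_continuous[OF \<alpha> Fcont] p]) (auto simp: p_def)
    then show ?thesis
      unfolding U_def by (intro continuous_intros p)
  qed
  \<comment> \<open>\<open>U 0\<close> is bounded, and the Lipschitz estimate carries boundedness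
    over to every \<open>U g\<close>, so that \<open>U\<close> maps the space into itself.\<close>
  have U0: "norm (U 0 t) \<le> norm x0" for t
  proof -
    have "F 0 i = (\<lambda>_. 0)" for i by (simp add: F_def fun_eq_iff)
    then have "U 0 t = exp (- s * p t) *\<^sub>R x0"
      by (simp add: U_def vec_eq_iff RL_integral_def)
    moreover have "exp (- s * p t) * norm x0 \<le> 1 * norm x0"
      using s by (intro mult_right_mono) (simp_all add: p_def)
    ultimately show ?thesis by simp
  qed
  have Ubcont: "U g \<in> bcontfun" for g
  proof -
    have "norm (U g t) \<le> norm x0 + 1/2 * dist g 0" for t
      using norm_triangle_sub[of "U g t" "U 0 t"] U_diff[of g t 0] U0[of t] by linarith
    then have "bounded (range (U g))"
      unfolding bounded_iff by auto
    then show ?thesis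
      unfolding bcontfun_def using Ucont by simp
  qed
  have app: "apply_bcontfun (Bcontfun (U g)) = U g" for g
    by (rule Bcontfun_inverse[OF Ubcont])
  have "\<exists>!g. Bcontfun (U g) = g"
  proof (rule banach_fix_type[of "1/2"])
    show "\<forall>g h. dist (Bcontfun (U g)) (Bcontfun (U h)) \<le> 1/2 * dist g h"
      by (intro allI dist_bound) (use U_diff in \<open>simp add: app dist_norm\<close>)
  qed auto
  then obtain g where g: "Bcontfun (U g) = g" by auto
  define x where "x t = exp (s * t) *\<^sub>R g t" for t
  have "x t $ i = x0 $ i + RL_integral (\<alpha> $ i) (\<lambda>\<tau>. \<Sum>j\<in>UNIV. A $ i $ j * x \<tau> $ j) t" if "0 \<le> t" for t i
  proof -
    have "g t $ i = exp (- s * t) * (x0 $ i + RL_integral (\<alpha> $ i) (F g i) t)"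
      using app[of g] that unfolding g by (simp add: U_def p_def)
    moreover have "F g i = (\<lambda>\<tau>. \<Sum>j\<in>UNIV. A $ i $ j * x \<tau> $ j)"
      by (simp add: F_def x_def fun_eq_iff)
    ultimately show ?thesis
      by (simp add: x_def exp_minus field_simps)
  qed
  moreover have "continuous_on {0..} x"
    unfolding x_def by (intro continuous_intros continuous_on_apply_bcontfun)
  ultimately show ?thesis by (rule that[rotated])
qed

text \<open>J^(1-\<alpha>) applied to x - x0 = J^\<alpha> (A x) gives the ordinary integral of A x,
  and the fundamental theorem of calculus finishes since A x is continuous.\<close>

lemma Volterra_imp_caputo_solution:
  fixes \<alpha> x0 :: "real ^ 'n" and A :: "real ^ 'n ^ 'n"
  assumes \<alpha>: "\<And>i. 0 < \<alpha> $ i \<and> \<alpha> $ i \<le> 1"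
    and x: "continuous_on {0..} x"
    and eq: "\<And>t i. 0 \<le> t \<Longrightarrow>
      x t $ i = x0 $ i + RL_integral (\<alpha> $ i) (\<lambda>\<tau>. \<Sum>j\<in>UNIV. A $ i $ j * x \<tau> $ j) t"
  shows "caputo_solution \<alpha> A x" "x 0 = x0"
proof -
  show x0: "x 0 = x0"
    using eq[of 0] \<alpha> by (auto simp: vec_eq_iff RL_integral_def less_imp_neq[symmetric])
  show "caputo_solution \<alpha> A x"
    unfolding caputo_solution_def has_caputo_derivative_def
  proof (intro conjI x allI impI)
    fix t :: real and i :: 'n
    assume t: "t > 0"
    define g where "g \<tau> = (\<Sum>j\<in>UNIV. A $ i $ j * x \<tau> $ j)" for \<tau>
    have g: "continuous_on {0..} g"
      unfolding g_def by (intro continuous_intros x)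
    have J: "RL_integral (1 - \<alpha> $ i) (\<lambda>\<tau>. x \<tau> $ i - x 0 $ i) u = integral {0..u} g" if "u > 0" for u
    proof -
      have "RL_integral (1 - \<alpha> $ i) (\<lambda>\<tau>. x \<tau> $ i - x 0 $ i) u = RL_integral (1 - \<alpha> $ i) (RL_integral (\<alpha> $ i) g) u"
        using that unfolding x0 by (intro RL_integral_cong) (auto simp: eq g_def[abs_def])
      also have "\<dots> = integral {0..u} g"
      proof (cases "\<alpha> $ i = 1")
        case True
        \<comment> \<open>Order 0 is the identity, so only the integral of order 1 remains. Its
          kernel is 0 powr 0 = 0 at \<tau> = u instead of 1, which is repaired on a null
          set.\<close>
        have "integral {0..u} (\<lambda>\<tau>. (u - \<tau>) powr (1 - 1) * g \<tau>) = integral {0..u} g"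
          by (rule integral_spike[of "{u}"]) auto
        then show ?thesis by (simp add: RL_integral_def True)
      next
        case False
        then show ?thesis
          using \<alpha>[of i] g that by (intro RL_integral_compose RL_integral_continuous) auto
      qed
      finally show ?thesis .
    qed
    have "((\<lambda>u. integral {0..u} g) has_real_derivative g t) (at t within {0..t + 1})"
      by (rule integral_has_real_derivative) (use t in \<open>auto intro: continuous_on_subset[OF g]\<close>)
    moreover have "t \<in> interior {0..t + 1}"
      using t unfolding interior_atLeastAtMost_real by simp
    ultimately have "((\<lambda>u. integral {0..u} g) has_real_derivative g t) (at t)"
      by (simp only: at_within_interior)
    then show "(RL_integral (1 - \<alpha> $ i) (\<lambda>\<tau>. x \<tau> $ i - x 0 $ i)
        has_real_derivative (\<Sum>j\<in>UNIV. A $ i $ j * x t $ j)) (at t)"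
      unfolding g_def[symmetric]
      by (rule has_field_derivative_transform_within_open[of _ _ _ "{0<..}"]) (use t J in auto)
  qed
qed

section \<open>Laplace transforms of bounded solutions\<close>

definition laplace :: "(real \<Rightarrow> real) \<Rightarrow> complex \<Rightarrow> complex" where
  "laplace f s = (\<integral>t. indicator {0..} t *\<^sub>R (exp (- s * of_real t) * of_real (f t)) \<partial>lborel)"

text \<open>The kernel of order 1 is the Heaviside function, so \<open>rl_kernel_laplace\<close> at
  \<beta> = 1 also supplies plain exponential integrals and the transform of a constant.\<close>

lemma rl_kernel_1: "rl_kernel 1 u = indicator {0<..} u"
  by (simp add: rl_kernel_def)

text \<open>The decay exp (- e t) is split into two halves: one yields the factor exp (- (e / 2) N),
  the other keeps the majorant integrable. The bound is uniform over Re s \<ge> e, and N = 0 gives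
  the existence of the transform.\<close>

lemma exp_tail_bound:
  fixes f :: "real \<Rightarrow> real"
  assumes f: "continuous_on {0..} f" and M: "\<And>t. 0 \<le> t \<Longrightarrow> \<bar>f t\<bar> \<le> M"
    and e: "0 < e" "e \<le> Re s" and N: "0 \<le> N"
  shows "integrable lborel (\<lambda>t. indicator {N..} t *\<^sub>R (exp (- s * of_real t) * of_real (f t)))"
    "norm (\<integral>t. indicator {N..} t *\<^sub>R (exp (- s * of_real t) * of_real (f t)) \<partial>lborel)
      \<le> exp (- (e / 2) * N) * (M * (2 / e))"
proof -
  have M0: "M \<ge> 0" using M[of 0] by simp
  define w where "w t = exp (- (e / 2) * N) * (M * (exp (- (e / 2) * t) * rl_kernel 1 t))" for t
  have "has_bochner_integral lborel w (exp (- (e / 2) * N) * (M * ((e / 2) powr (- 1))))"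
    unfolding w_def using e
    by (intro has_bochner_integral_mult_right rl_kernel_laplace) auto
  then have w: "has_bochner_integral lborel w (exp (- (e / 2) * N) * (M * (2 / e)))"
    using e by (simp add: powr_minus_divide)
  have "(\<lambda>t. complex_of_real (indicator {0..} t * f t)) \<in> borel_measurable borel"
    using continuous_on_halfline_measurable[OF f] by measurable
  then have "(\<lambda>t. indicator {N..} t *\<^sub>R (exp (- s * of_real t) * complex_of_real (indicator {0..} t * f t)))
      \<in> borel_measurable borel"
    by measurable
  also have "(\<lambda>t. indicator {N..} t *\<^sub>R (exp (- s * of_real t) * complex_of_real (indicator {0..} t * f t)))
      = (\<lambda>t. indicator {N..} t *\<^sub>R (exp (- s * of_real t) * of_real (f t)))"
    using N by (auto simp: fun_eq_iff indicator_def)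
  finally have meas: "(\<lambda>t. indicator {N..} t *\<^sub>R (exp (- s * of_real t) * of_real (f t))) \<in> borel_measurable lborel"
    by simp
  \<comment> \<open>Only almost everywhere, because the majorant vanishes at t = 0, where
    \<open>rl_kernel 1\<close> is 0.\<close>
  have le: "AE t in lborel. norm (indicator {N..} t *\<^sub>R (exp (- s * of_real t) * of_real (f t))) \<le> w t"
    using AE_lborel_singleton[of 0]
  proof eventually_elim
    case (elim t)
    show ?case
    proof (cases "N \<le> t")
      case True
      then have t: "t > 0" using elim N by simp
      have "norm (exp (- s * of_real t)) = exp (- Re s * t)" by simp
      also have "\<dots> \<le> exp (- e * t)" using e t by simp
      also have "\<dots> = exp (- (e / 2) * t) * exp (- (e / 2) * t)" by (simp add: exp_add[symmetric])
      also have "\<dots> \<le> exp (- (e / 2) * N) * exp (- (e / 2) * t)"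
        using e True by (intro mult_right_mono) auto
      finally have "norm (exp (- s * of_real t)) * \<bar>f t\<bar> \<le> (exp (- (e / 2) * N) * exp (- (e / 2) * t)) * M"
        using M[of t] t by (intro mult_mono) auto
      then show ?thesis
        using True t by (simp add: norm_mult w_def rl_kernel_1 mult_ac)
    next
      case False
      then show ?thesis using M0 by (simp add: w_def rl_kernel_1)
    qed
  qed
  show int: "integrable lborel (\<lambda>t. indicator {N..} t *\<^sub>R (exp (- s * of_real t) * of_real (f t)))"
  proof (rule Bochner_Integration.integrable_bound[OF _ meas])
    show "integrable lborel w" using w by (simp add: has_bochner_integral_iff)
    show "AE t in lborel. norm (indicator {N..} t *\<^sub>R (exp (- s * of_real t) * complex_of_real (f t))) \<le> norm (w t)"
      using le by eventually_elim auto
  qed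
  have "norm (\<integral>t. indicator {N..} t *\<^sub>R (exp (- s * of_real t) * of_real (f t)) \<partial>lborel)
      \<le> (\<integral>t. norm (indicator {N..} t *\<^sub>R (exp (- s * of_real t) * complex_of_real (f t))) \<partial>lborel)"
    by (rule integral_norm_bound)
  also have "\<dots> \<le> (\<integral>t. w t \<partial>lborel)"
    by (rule integral_mono_AE[OF integrable_norm[OF int] _ le]) (use w in \<open>simp add: has_bochner_integral_iff\<close>)
  also have "\<dots> = exp (- (e / 2) * N) * (M * (2 / e))"
    using w by (simp add: has_bochner_integral_iff)
  finally show "norm (\<integral>t. indicator {N..} t *\<^sub>R (exp (- s * of_real t) * of_real (f t)) \<partial>lborel)
      \<le> exp (- (e / 2) * N) * (M * (2 / e))" .
qed

text \<open>The integrals truncated to [0, n] are holomorphic by differentiation under the integral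
  sign, and by the tail bound they converge locally uniformly.\<close>

lemma laplace_holomorphic:
  assumes f: "continuous_on {0..} f" and M: "\<And>t. 0 \<le> t \<Longrightarrow> \<bar>f t\<bar> \<le> M"
  shows "laplace f holomorphic_on {s. Re s > 0}"
proof (rule holomorphic_uniform_sequence)
  show "open {s. Re s > 0}" by (rule open_halfspace_Re_gt)
  define L where "L n s = integral (cbox 0 (real n)) (\<lambda>t. exp (- s * of_real t) * complex_of_real (f t))" for n s
  have cf: "continuous_on (cbox 0 (real n)) f" for n
    by (rule continuous_on_subset[OF f]) auto
  show "L n holomorphic_on {s. Re s > 0}" for n
    unfolding L_def
  proof (rule leibniz_rule_holomorphic)
    show "((\<lambda>s. exp (- s * of_real t) * complex_of_real (f t)) has_field_derivative
        - of_real t * exp (- s * of_real t) * complex_of_real (f t)) (at s within {s. Re s > 0})" for s t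
      by (auto intro!: derivative_eq_intros)
    show "(\<lambda>t. exp (- s * of_real t) * complex_of_real (f t)) integrable_on cbox 0 (real n)" for s
      by (intro integrable_continuous continuous_intros cf)
    have "continuous_on ({s. Re s > 0} \<times> cbox 0 (real n)) (\<lambda>p. f (snd p))"
      by (rule continuous_on_compose2[OF cf[of n]]) (auto intro: continuous_intros)
    then show "continuous_on ({s. Re s > 0} \<times> cbox 0 (real n))
        (\<lambda>(s, t). - of_real t * exp (- s * of_real t) * complex_of_real (f t))"
      unfolding case_prod_unfold by (intro continuous_intros)
    show "convex {s. Re s > 0}" by (rule convex_halfspace_Re_gt)
  qed
  show "\<exists>d>0. cball x d \<subseteq> {s. Re s > 0} \<and> uniform_limit (cball x d) L (laplace f) sequentially"
    if "x \<in> {s. Re s > 0}" for x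
  proof (intro exI conjI)
    \<comment> \<open>Half the distance to the imaginary axis: the closed disc of radius
      \<open>e\<close> about \<open>x\<close> stays in Re s \<ge> e, where the tail bound is
      uniform.\<close>
    define e where "e = Re x / 2"
    have e: "e > 0" using that by (simp add: e_def)
    then show "e > 0" .
    have Re: "e \<le> Re s" if "s \<in> cball x e" for s
      using abs_Re_le_cmod[of "x - s"] that by (auto simp: e_def dist_norm)
    then show "cball x e \<subseteq> {s. Re s > 0}" using e by force
    have diff: "dist (L n s) (laplace f s) \<le> exp (- (e / 2) * real n) * (M * (2 / e))" if s: "s \<in> cball x e" for n s
    proof -
      define h where "h t = exp (- s * of_real t) * complex_of_real (f t)" for t
      have I0: "integrable lborel (\<lambda>t. indicator {0..} t *\<^sub>R h t)"
        unfolding h_def by (rule exp_tail_bound[OF f M e Re[OF s]]) auto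
      have In: "integrable lborel (\<lambda>t. indicator {real n..} t *\<^sub>R h t)"
        unfolding h_def by (rule exp_tail_bound[OF f M e Re[OF s]]) auto
      have "continuous_on {0..real n} h"
        unfolding h_def using cf[of n] by (intro continuous_intros) auto
      then have S: "set_integrable lborel {0..real n} h"
        by (rule borel_integrable_atLeastAtMost')
      have "(\<integral>t. indicator {0..} t *\<^sub>R h t \<partial>lborel)
          = (\<integral>t. indicator {0..real n} t *\<^sub>R h t + indicator {real n..} t *\<^sub>R h t \<partial>lborel)"
      proof (rule integral_cong_AE)
        show "AE t in lborel. indicator {0..} t *\<^sub>R h t = indicator {0..real n} t *\<^sub>R h t + indicator {real n..} t *\<^sub>R h t"
          using AE_lborel_singleton[of "real n"] by eventually_elim (auto simp: indicator_def)
      qed (use I0 In S in \<open>auto simp: set_integrable_def\<close>)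
      also have "\<dots> = L n s + (\<integral>t. indicator {real n..} t *\<^sub>R h t \<partial>lborel)"
        using In S set_borel_integral_eq_integral(2)[OF S]
        by (simp add: set_integrable_def set_lebesgue_integral_def L_def h_def[abs_def])
      finally have "dist (L n s) (laplace f s) = norm (\<integral>t. indicator {real n..} t *\<^sub>R h t \<partial>lborel)"
        by (simp add: laplace_def h_def dist_norm)
      also have "\<dots> \<le> exp (- (e / 2) * real n) * (M * (2 / e))"
        unfolding h_def by (rule exp_tail_bound[OF f M e Re[OF s]]) auto
      finally show ?thesis .
    qed
    have "filterlim (\<lambda>n. - (e / 2) * real n) at_bot sequentially"
      using e by (intro filterlim_tendsto_neg_mult_at_bot[OF tendsto_const] filterlim_real_sequentially) auto
    then have "(\<lambda>n. exp (- (e / 2) * real n)) \<longlonglongrightarrow> 0"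
      by (rule filterlim_compose[OF exp_at_bot])
    then have lim: "(\<lambda>n. exp (- (e / 2) * real n) * (M * (2 / e))) \<longlonglongrightarrow> 0"
      by (rule tendsto_mult_left_zero)
    show "uniform_limit (cball x e) L (laplace f) sequentially"
    proof (rule uniform_limitI)
      fix r :: real assume "r > 0"
      from order_tendstoD(2)[OF lim this]
      show "\<forall>\<^sub>F n in sequentially. \<forall>s\<in>cball x e. dist (L n s) (laplace f s) < r"
        by eventually_elim (blast intro: order.strict_trans1[OF diff])
    qed
  qed
qed

text \<open>At positive real points the transform is a real integral, so the convolution theorem can
  be proved with real integrands.\<close>

lemma laplace_has_integral_real:
  fixes f :: "real \<Rightarrow> real"
  assumes f: "continuous_on {0..} f" and M: "\<And>t. 0 \<le> t \<Longrightarrow> \<bar>f t\<bar> \<le> M" and s: "s > 0"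
  shows "has_bochner_integral lborel (\<lambda>t. exp (- s * t) * (indicator {0..} t * f t)) (Re (laplace f (of_real s)))"
    "Im (laplace f (of_real s)) = 0"
proof -
  have "integrable lborel (\<lambda>t. indicator {0..} t *\<^sub>R (exp (- complex_of_real s * of_real t) * of_real (f t)))"
    by (rule exp_tail_bound[OF f M s]) auto
  moreover have "(\<lambda>t. indicator {0..} t *\<^sub>R (exp (- complex_of_real s * of_real t) * of_real (f t)))
     = (\<lambda>t. complex_of_real (exp (- s * t) * (indicator {0..} t * f t)))"
    by (auto simp: fun_eq_iff indicator_def exp_of_real[symmetric])
  ultimately have "has_bochner_integral lborel (\<lambda>t. complex_of_real (exp (- s * t) * (indicator {0..} t * f t)))
      (laplace f (of_real s))"
    unfolding laplace_def has_bochner_integral_iff by simp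
  from has_bochner_integral_Re[OF this] has_bochner_integral_Im[OF this]
  show "has_bochner_integral lborel (\<lambda>t. exp (- s * t) * (indicator {0..} t * f t)) (Re (laplace f (of_real s)))"
    "Im (laplace f (of_real s)) = 0"
    by (simp_all add: has_bochner_integral_iff)
qed

text \<open>The convolution theorem: exp (- s v) = exp (- s (v - w)) exp (- s w) under Fubini.
  Integrability belongs to the conclusion and cannot be taken from \<open>exp_tail_bound\<close>,
  since J^\<beta> f may be unbounded for bounded \<open>f\<close>.\<close>

lemma laplace_RL_integral:
  fixes f :: "real \<Rightarrow> real"
  assumes b: "\<beta> > 0" and f: "continuous_on {0..} f" and M: "\<And>t. 0 \<le> t \<Longrightarrow> \<bar>f t\<bar> \<le> M" and s: "s > 0"
  shows "has_bochner_integral lborel (\<lambda>t. exp (- s * t) * (indicator {0..} t * RL_integral \<beta> f t))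
    (s powr (- \<beta>) * Re (laplace f (of_real s)))"
proof -
  define f0 where "f0 u = indicator {0..} u * f u" for u
  have m[measurable]: "f0 \<in> borel_measurable borel"
    unfolding f0_def[abs_def] by (rule continuous_on_halfline_measurable[OF f])
  define k where "k u = exp (- s * u) * rl_kernel \<beta> u" for u
  have mk[measurable]: "k \<in> borel_measurable borel"
    unfolding k_def[abs_def] by measurable
  have k0: "k u \<ge> 0" for u by (simp add: k_def rl_kernel_nonneg[OF b])
  have k: "has_bochner_integral lborel (\<lambda>v. k (v - w)) (s powr (- \<beta>))" for w
    using rl_kernel_laplace[OF b s] unfolding k_def[symmetric]
    by (subst (asm) lborel_has_bochner_integral_real_affine_iff[of 1 _ _ "- w"]) auto
  have h: "has_bochner_integral lborel (\<lambda>w. exp (- s * w) * f0 w) (Re (laplace f (of_real s)))"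
    using laplace_has_integral_real[OF f M s] by (simp add: f0_def)
  define F where "F w v = k (v - w) * (exp (- s * w) * f0 w)" for w v
  have Fint: "integrable (lborel \<Otimes>\<^sub>M lborel) (case_prod F)"
  proof (rule lborel_pair.Fubini_integrable)
    show "case_prod F \<in> borel_measurable (lborel \<Otimes>\<^sub>M lborel)"
      unfolding F_def by measurable
    have "(\<integral>v. norm (case (w, v) of (w, v) \<Rightarrow> F w v) \<partial>lborel) = s powr (- \<beta>) * norm (exp (- s * w) * f0 w)" for w
      using k[of w] k0 by (simp add: F_def abs_mult has_bochner_integral_iff)
    moreover have "integrable lborel (\<lambda>w. s powr (- \<beta>) * norm (exp (- s * w) * f0 w))"
      using h by (intro integrable_mult_right integrable_norm) (auto simp: has_bochner_integral_iff)
    ultimately show "integrable lborel (\<lambda>w. \<integral>v. norm (case (w, v) of (w, v) \<Rightarrow> F w v) \<partial>lborel)"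
      by simp
    show "AE w in lborel. integrable lborel (\<lambda>v. case (w, v) of (w, v) \<Rightarrow> F w v)"
      using k by (intro AE_I2) (simp add: F_def has_bochner_integral_iff)
  qed
  have inner: "(\<integral>w. F w v \<partial>lborel) = exp (- s * v) * (indicator {0..} v * RL_integral \<beta> f v)" for v
  proof (cases "v \<ge> 0")
    case True
    have "F w v = exp (- s * v) * (rl_kernel \<beta> (v - w) * f0 w)" for w
      by (simp add: F_def k_def right_diff_distrib exp_diff exp_minus field_simps)
    then show ?thesis
      using True RL_integral_eq_convolution[OF b f] by (simp add: f0_def)
  next
    case False
    then have "F w v = 0" for w by (auto simp: F_def k_def f0_def rl_kernel_def indicator_def)
    then show ?thesis using False by simp
  qed
  have "integrable lborel (\<lambda>v. \<integral>w. F w v \<partial>lborel)"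
    using lborel_pair.integrable_snd[OF Fint] .
  moreover have "(\<integral>v. (\<integral>w. F w v \<partial>lborel) \<partial>lborel) = (\<integral>w. (\<integral>v. F w v \<partial>lborel) \<partial>lborel)"
    by (rule lborel_pair.Fubini_integral[OF Fint])
  moreover have "\<dots> = s powr (- \<beta>) * Re (laplace f (of_real s))"
    using k h by (simp add: F_def has_bochner_integral_iff)
  ultimately show ?thesis
    unfolding inner by (simp add: has_bochner_integral_iff)
qed

text \<open>Proved for real \<open>s\<close> first and then extended by analytic continuation.\<close>

lemma laplace_Volterra:
  fixes \<alpha> x0 :: "real ^ 'n" and A :: "real ^ 'n ^ 'n"
  assumes \<alpha>: "\<And>i. 0 < \<alpha> $ i"
    and x: "continuous_on {0..} x" and M: "\<And>t. 0 \<le> t \<Longrightarrow> norm (x t) \<le> M"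
    and eq: "\<And>t i. 0 \<le> t \<Longrightarrow>
      x t $ i = x0 $ i + RL_integral (\<alpha> $ i) (\<lambda>\<tau>. \<Sum>j\<in>UNIV. A $ i $ j * x \<tau> $ j) t"
    and s: "Re s > 0"
  shows "s powr of_real (\<alpha> $ i) * laplace (\<lambda>t. x t $ i) s - (\<Sum>j\<in>UNIV. of_real (A $ i $ j) * laplace (\<lambda>t. x t $ j) s)
    = s powr of_real (\<alpha> $ i) * (of_real (x0 $ i) / s)"
proof -
  have xc: "continuous_on {0..} (\<lambda>t. x t $ j)" for j by (intro continuous_intros x)
  have xM: "\<bar>x t $ j\<bar> \<le> M" if "0 \<le> t" for t j
    using component_le_norm_cart[of "x t" j] M[OF that] by simp
  define X where "X j = laplace (\<lambda>t. x t $ j)" for j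
  define G where "G s = s powr of_real (\<alpha> $ i) * X i s - (\<Sum>j\<in>UNIV. of_real (A $ i $ j) * X j s)
    - s powr of_real (\<alpha> $ i) * (of_real (x0 $ i) / s)" for s
  have hol: "G holomorphic_on {s. Re s > 0}"
    unfolding G_def X_def
    by (intro holomorphic_intros laplace_holomorphic[OF xc xM]) (auto simp: complex_nonpos_Reals_iff)
  have real: "G (of_real r) = 0" if r: "r > 0" for r
  proof -
    define g where "g \<tau> = (\<Sum>j\<in>UNIV. A $ i $ j * x \<tau> $ j)" for \<tau>
    have g: "continuous_on {0..} g"
      unfolding g_def by (intro continuous_intros x)
    have gM: "\<bar>g t\<bar> \<le> (\<Sum>j\<in>UNIV. \<bar>A $ i $ j\<bar> * M)" if "0 \<le> t" for t
      unfolding g_def using xM[OF that]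
      by (intro order_trans[OF sum_abs sum_mono]) (simp add: abs_mult mult_left_mono)
    note Xr = laplace_has_integral_real[OF xc xM r]
    have X_of_real: "X j (of_real r) = of_real (Re (X j (of_real r)))" for j
      unfolding X_def using Xr(2)[of j] by (simp add: complex_eq_iff)
    have "has_bochner_integral lborel (\<lambda>t. \<Sum>j\<in>UNIV. A $ i $ j * (exp (- r * t) * (indicator {0..} t * x t $ j)))
        (\<Sum>j\<in>UNIV. A $ i $ j * Re (X j (of_real r)))"
      unfolding X_def by (intro has_bochner_integral_sum has_bochner_integral_mult_right Xr)
    moreover have "(\<lambda>t. \<Sum>j\<in>UNIV. A $ i $ j * (exp (- r * t) * (indicator {0..} t * x t $ j)))
        = (\<lambda>t. exp (- r * t) * (indicator {0..} t * g t))"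
      by (auto simp: fun_eq_iff g_def sum_distrib_left mult_ac intro!: sum.cong)
    ultimately have Lg: "Re (laplace g (of_real r)) = (\<Sum>j\<in>UNIV. A $ i $ j * Re (X j (of_real r)))"
      using laplace_has_integral_real(1)[OF g gM r] by (simp add: has_bochner_integral_iff)
    \<comment> \<open>The initial value is transformed through the kernel of order 1, which differs
      from the constant 1 on {0..} only at t = 0.\<close>
    have "has_bochner_integral lborel (\<lambda>t. exp (- r * t) * (indicator {0..} t * RL_integral (\<alpha> $ i) g t)
        + x0 $ i * (exp (- r * t) * rl_kernel 1 t))
        (r powr (- \<alpha> $ i) * Re (laplace g (of_real r)) + x0 $ i * r powr (- 1))"
      by (intro has_bochner_integral_add has_bochner_integral_mult_right laplace_RL_integral[OF _ g gM r]
          rl_kernel_laplace r \<alpha>) auto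
    then have "(\<integral>t. exp (- r * t) * (indicator {0..} t * RL_integral (\<alpha> $ i) g t)
        + x0 $ i * (exp (- r * t) * rl_kernel 1 t) \<partial>lborel)
        = r powr (- \<alpha> $ i) * Re (laplace g (of_real r)) + x0 $ i * r powr (- 1)"
      and "integrable lborel (\<lambda>t. exp (- r * t) * (indicator {0..} t * RL_integral (\<alpha> $ i) g t)
        + x0 $ i * (exp (- r * t) * rl_kernel 1 t))"
      by (simp_all add: has_bochner_integral_iff)
    moreover have "(\<integral>t. exp (- r * t) * (indicator {0..} t * RL_integral (\<alpha> $ i) g t)
        + x0 $ i * (exp (- r * t) * rl_kernel 1 t) \<partial>lborel)
      = (\<integral>t. exp (- r * t) * (indicator {0..} t * x t $ i) \<partial>lborel)"
    proof (rule integral_cong_AE)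
      show "AE t in lborel. exp (- r * t) * (indicator {0..} t * RL_integral (\<alpha> $ i) g t)
          + x0 $ i * (exp (- r * t) * rl_kernel 1 t) = exp (- r * t) * (indicator {0..} t * x t $ i)"
        using AE_lborel_singleton[of 0]
      proof eventually_elim
        case (elim t)
        then show ?case
          using eq[of t i] by (cases "t > 0") (auto simp: rl_kernel_1 g_def[abs_def] algebra_simps)
      qed
    qed (use calculation(2) Xr(1)[of i, THEN integrable.intros] in \<open>auto dest!: borel_measurable_integrable\<close>)
    ultimately have "Re (X i (of_real r)) = r powr (- \<alpha> $ i) * Re (laplace g (of_real r)) + x0 $ i / r"
      using Xr(1)[of i] r unfolding X_def by (simp add: has_bochner_integral_iff powr_minus_divide)
    then have "r powr \<alpha> $ i * Re (X i (of_real r)) = (\<Sum>j\<in>UNIV. A $ i $ j * Re (X j (of_real r))) + r powr \<alpha> $ i * (x0 $ i / r)"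
      unfolding Lg using r by (simp add: powr_minus field_simps)
    then have "complex_of_real (r powr \<alpha> $ i * Re (X i (of_real r)))
        = of_real ((\<Sum>j\<in>UNIV. A $ i $ j * Re (X j (of_real r))) + r powr \<alpha> $ i * (x0 $ i / r))"
      by simp
    then show ?thesis
      unfolding G_def using r
      by (simp add: powr_of_real[symmetric] X_of_real[symmetric])
  qed
  have "G s = 0"
  proof (rule analytic_continuation[OF hol])
    show "complex_of_real ` {0<..} \<subseteq> {s. Re s > 0}" by auto
    show "1 islimpt complex_of_real ` {0<..}"
      unfolding islimpt_approachable
    proof (intro allI impI)
      fix e :: real assume "e > 0"
      then show "\<exists>x'\<in>complex_of_real ` {0<..}. x' \<noteq> 1 \<and> dist x' 1 < e"
        by (intro bexI[of _ "complex_of_real (1 + e / 2)"]) (auto simp: dist_norm complex_eq_iff)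
    qed
  qed (use s real in \<open>auto intro: open_halfspace_Re_gt convex_connected convex_halfspace_Re_gt\<close>)
  then show ?thesis by (simp add: G_def X_def)
qed

text \<open>The solutions built from the Volterra equation are themselves Caputo solutions, hence
  covered by the stability bound; their boundedness makes their transforms available at every
  \<open>s\<close> with Re s > 0.\<close>

lemma stable_imp_charfun_nonzero:
  fixes \<alpha> :: "real ^ 'n" and A :: "real ^ 'n ^ 'n"
  assumes \<alpha>: "\<And>i. 0 < \<alpha> $ i \<and> \<alpha> $ i \<le> 1" and stable: "caputo_stable \<alpha> A" and s: "Re s > 0"
  shows "caputo_charfun \<alpha> A s \<noteq> 0"
proof -
  have \<alpha>0: "\<And>i. 0 < \<alpha> $ i" using \<alpha> by simp
  \<comment> \<open>Stability enters once, with \<epsilon> = 1; the initial vectors have length d /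
    2 to stay strictly below the threshold.\<close>
  from stable obtain d where d: "d > 0"
    and bnd: "\<And>x t. caputo_solution \<alpha> A x \<Longrightarrow> norm (x 0) < d \<Longrightarrow> t \<ge> 0 \<Longrightarrow> norm (x t) < 1"
    unfolding caputo_stable_def by (metis zero_less_one)
  define P where "P k X \<longleftrightarrow> (\<forall>i. s powr of_real (\<alpha> $ i) * X i - (\<Sum>j\<in>UNIV. of_real (A $ i $ j) * X j)
      = s powr of_real (\<alpha> $ i) * (of_real (axis k (d / 2) $ i) / s))" for k :: 'n and X
  have "\<exists>X. P k X" for k
  proof -
    obtain x where x: "continuous_on {0..} x"
      and eq: "\<And>t i. 0 \<le> t \<Longrightarrow> x t $ i = axis k (d / 2) $ i
          + RL_integral (\<alpha> $ i) (\<lambda>\<tau>. \<Sum>j\<in>UNIV. A $ i $ j * x \<tau> $ j) t"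
      using ex_Volterra_solution[OF \<alpha>0, where ?x0.0 = "axis k (d / 2)" and A = A] by blast
    note sol = Volterra_imp_caputo_solution[OF \<alpha> x eq]
    have "norm (axis k (d / 2) :: real ^ 'n) = d / 2"
      using d by (simp add: norm_eq_sqrt_inner[of "axis k (d / 2)"] inner_axis_axis real_sqrt_divide)
    then have "norm (x 0) < d" using sol(2) d by simp
    then have bound: "norm (x t) \<le> 1" if "0 \<le> t" for t
      using bnd[OF sol(1) _ that] by simp
    have "P k (\<lambda>j. laplace (\<lambda>t. x t $ j) s)"
      unfolding P_def by (intro allI laplace_Volterra[OF \<alpha>0 x _ _ s]) (fact bound eq)+
    then show ?thesis by (rule exI[of "P k"])
  qed
  then obtain X where PX: "\<And>k. P k (X k)" by metis
  have X: "s powr of_real (\<alpha> $ i) * X k i - (\<Sum>j\<in>UNIV. of_real (A $ i $ j) * X k j)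
      = s powr of_real (\<alpha> $ i) * (of_real (axis k (d / 2) $ i) / s)" for k i
    by (rule PX[unfolded P_def, THEN spec])
  define Q :: "complex ^ 'n ^ 'n" where
    "Q = (\<chi> i j. (if i = j then s powr of_real (\<alpha> $ i) else 0) - of_real (A $ i $ j))"
  define Y :: "complex ^ 'n ^ 'n" where "Y = (\<chi> j k. X k j)"
  \<comment> \<open>The factor 1 / s is the transform of the constant initial value; off the
    diagonal \<open>axis k (d / 2)\<close> vanishes.\<close>
  define D :: "complex ^ 'n ^ 'n" where
    "D = (\<chi> i k. s powr of_real (\<alpha> $ i) * (of_real (axis k (d / 2) $ i) / s))"
  have "(Q ** Y) $ i $ k = D $ i $ k" for i k
  proof -
    have "(Q ** Y) $ i $ k
        = (\<Sum>j\<in>UNIV. (if i = j then s powr of_real (\<alpha> $ i) * X k j else 0) - of_real (A $ i $ j) * X k j)"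
      unfolding matrix_matrix_mult_def Q_def Y_def vec_lambda_beta
      by (rule sum.cong) (auto simp: left_diff_distrib)
    also have "\<dots> = s powr of_real (\<alpha> $ i) * X k i - (\<Sum>j\<in>UNIV. of_real (A $ i $ j) * X k j)"
      by (simp add: sum_subtractf)
    finally show ?thesis
      using X[where k = k and i = i] by (simp add: D_def)
  qed
  then have "Q ** Y = D" by (simp add: vec_eq_iff)
  then have "det Q * det Y = det D" by (metis det_mul)
  moreover have "det D = (\<Prod>i\<in>UNIV. D $ i $ i)"
    by (rule det_diagonal) (simp add: D_def axis_def)
  moreover have "(\<Prod>i\<in>UNIV. D $ i $ i) \<noteq> 0"
    using s d by (auto simp: D_def)
  ultimately show ?thesis
    by (auto simp: caputo_charfun_def Q_def)
qed

section \<open>Zeros in the right half-plane\<close>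

text \<open>A trapping principle: a path that starts inside a window and never meets its endpoints
  stays inside. It keeps a continuous argument in a window whose endpoints are excluded by the sign
  of a sine or cosine.\<close>

lemma IVT_abs_less:
  fixes h :: "real \<Rightarrow> real"
  assumes "continuous_on {a..b} h" "a \<le> b" "\<bar>h a\<bar> < c" "\<And>t. a \<le> t \<Longrightarrow> t \<le> b \<Longrightarrow> \<bar>h t\<bar> \<noteq> c"
  shows "\<bar>h b\<bar> < c"
proof (rule ccontr)
  assume "\<not> \<bar>h b\<bar> < c"
  then have "\<exists>t. a \<le> t \<and> t \<le> b \<and> \<bar>h t\<bar> = c"
    using assms by (intro IVT') (auto intro: continuous_intros)
  then show False using assms(4) by blast
qed

text \<open>
  The imaginary part of a continuous logarithm \<open>g\<close> of \<open>Q\<close> on the closed first quadrant vanishes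
  on the real half-line, stays in \<open>{-pi<..<0}\<close> on the imaginary half-line because \<open>Im Q < 0\<close>
  there, and exceeds \<open>\<sigma> * pi / 2 - pi / 2\<close> at the upper end of a large arc, where \<open>Q\<close> is
  dominated by \<open>s powr \<sigma>\<close>.
\<close>

lemma half_plane_zero_of_quadrant_winding:
  fixes Q :: "complex \<Rightarrow> complex" and \<sigma> :: real
  assumes cont: "continuous_on {z. 0 \<le> Re z \<and> 0 \<le> Im z} Q"
    and Q0: "Q 0 = of_real d" "d > 0"
    and real: "\<And>r. 0 < r \<Longrightarrow> Im (Q (of_real r)) = 0"
    and imag: "\<And>r. 0 < r \<Longrightarrow> Im (Q (\<i> * of_real r)) < 0"
    and \<sigma>: "\<sigma> \<ge> 2"
    and arc: "0 < R" "\<And>s. cmod s = R \<Longrightarrow> cmod (Q s - s powr of_real \<sigma>) < R powr \<sigma>"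
  shows "\<exists>s. 0 < Re s \<and> Q s = 0"
proof (rule ccontr)
  assume no: "\<not> (\<exists>s. 0 < Re s \<and> Q s = 0)"
  define S where "S = {z. 0 \<le> Re z \<and> 0 \<le> Im z}"
  \<comment> \<open>On the imaginary half-line the assumption for contradiction says nothing; there
    Im Q < 0 excludes zeros, and at the corner Q 0 = d > 0.\<close>
  have nz: "Q z \<noteq> 0" if "z \<in> S" for z
  proof (cases "Re z = 0")
    case True
    then have z: "z = \<i> * of_real (Im z)" by (simp add: complex_eq_iff)
    show ?thesis
    proof (cases "Im z = 0")
      case True
      then show ?thesis using z Q0 by simp
    next
      case False
      then have "Im (Q z) < 0" using imag[of "Im z"] z that by (simp add: S_def)
      then show ?thesis by auto
    qed
  next
    case False
    then show ?thesis using no that by (auto simp: S_def)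
  qed
  have "convex S"
    unfolding S_def Collect_conj_eq
    by (intro convex_Int convex_halfspace_Re_ge convex_halfspace_Im_ge)
  then have contr: "contractible S" by (rule convex_imp_contractible)
  obtain g0 where g0: "continuous_on S g0" "\<And>z. z \<in> S \<Longrightarrow> Q z = exp (g0 z)"
    using continuous_logarithm_on_contractible[OF cont[folded S_def] contr nz] by blast
  have "exp (g0 0) = exp (of_real (ln d))"
    using g0(2)[of 0] Q0 by (simp add: S_def exp_of_real)
  then obtain k where k: "g0 0 = of_real (ln d) + of_int (2 * k) * of_real pi * \<i>"
    unfolding exp_eq by auto
  \<comment> \<open>Subtracting \<open>k\<close> periods of the exponential normalises the logarithm
    to have argument 0 at the corner.\<close>
  define g where "g z = g0 z - of_int (2 * k) * of_real pi * \<i>" for z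
  have g: "continuous_on S g"
    unfolding g_def by (intro continuous_intros g0)
  have Qg: "Q z = exp (g z)" if "z \<in> S" for z
  proof -
    have "exp (g z) = exp (g0 z)" unfolding exp_eq by (rule exI[of _ "- k"]) (simp add: g_def)
    then show ?thesis using g0(2) that by simp
  qed
  have Img0: "Im (g 0) = 0" using k by (simp add: g_def)
  define h where "h z = Im (g z)" for z
  have h: "continuous_on S h" unfolding h_def by (intro continuous_intros g)
  have ImQ: "Im (Q z) = exp (Re (g z)) * sin (h z)" if "z \<in> S" for z
    using Qg[OF that] by (simp add: Im_exp h_def)

  have hR: "h (of_real R) = 0"
  proof -
    have s0: "sin (h (of_real t)) = 0" if "0 \<le> t" for t
    proof (cases "t = 0")
      case False
      then show ?thesis
        using that real[of t] ImQ[of "of_real t"] by (auto simp: S_def)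
    qed (use Img0 h_def in simp)
    \<comment> \<open>On the real half-line \<open>h\<close> takes only multiples of pi, so it
      cannot pass through pi / 2 or - pi / 2; the only multiple left is 0.\<close>
    have "\<bar>h (of_real R)\<bar> < pi / 2"
    proof (rule IVT_abs_less[of 0 R "\<lambda>t. h (of_real t)"])
      show "continuous_on {0..R} (\<lambda>t. h (of_real t))"
        by (rule continuous_on_compose2[OF h]) (auto simp: S_def intro: continuous_intros)
      show "\<bar>h (complex_of_real t)\<bar> \<noteq> pi / 2" if "0 \<le> t" "t \<le> R" for t
      proof
        assume "\<bar>h (complex_of_real t)\<bar> = pi / 2"
        then have "h (of_real t) = pi / 2 \<or> h (of_real t) = - (pi / 2)" by linarith
        moreover have "sin (pi / 2) \<noteq> 0" "sin (- (pi / 2)) \<noteq> 0" by simp_all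
        ultimately show False using s0[OF that(1)] by metis
      qed
    qed (use arc(1) Img0 h_def in auto)
    then show ?thesis
      using s0[of R] arc(1) sin_zero_pi_iff[of "h (of_real R)"] by simp
  qed

  have "h (\<i> * of_real R) < 0"
  proof -
    have ci: "continuous_on {0..R} (\<lambda>t. h (\<i> * of_real t))"
      by (rule continuous_on_compose2[OF h]) (auto simp: S_def intro!: continuous_intros)
    have neg: "sin (h (\<i> * of_real t)) < 0" if "0 < t" for t
      using imag[OF that] ImQ[of "\<i> * of_real t"] that by (simp add: S_def mult_less_0_iff)
    \<comment> \<open>Clamping \<open>t\<close> makes two-sided continuity at 0 available. It gives
      \<bar>h\<bar> < pi just after the start, and there sin h < 0 forces h < 0.\<close>
    have "isCont (\<lambda>t. h (\<i> * of_real (max 0 t))) 0"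
    proof (rule continuous_on_interior[of UNIV])
      show "continuous_on UNIV (\<lambda>t. h (\<i> * of_real (max 0 t)))"
        by (rule continuous_on_compose2[OF h]) (auto simp: S_def intro!: continuous_intros)
    qed simp
    then have "((\<lambda>t. h (\<i> * of_real (max 0 t))) \<longlongrightarrow> 0) (at 0)"
      using Img0 by (simp add: isCont_def h_def)
    from tendstoD[OF this pi_gt_zero] obtain e where e: "e > 0"
      "\<And>t. t \<noteq> 0 \<Longrightarrow> \<bar>t\<bar> < e \<Longrightarrow> \<bar>h (\<i> * of_real (max 0 t))\<bar> < pi"
      unfolding eventually_at by (auto simp: dist_norm)
    define \<omega> where "\<omega> = min R (e / 2)"
    have \<omega>: "0 < \<omega>" "\<omega> \<le> R" using e arc(1) by (auto simp: \<omega>_def)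
    have ab: "\<bar>h (\<i> * of_real \<omega>)\<bar> < pi"
      using e(2)[of \<omega>] \<omega> e(1) by (simp add: \<omega>_def max_def)
    have "h (\<i> * of_real \<omega>) < 0"
      using neg[OF \<omega>(1)] sin_ge_zero[of "h (\<i> * of_real \<omega>)"] ab by linarith
    \<comment> \<open>The window from - pi to 0, recentred at - pi / 2; at both endpoints the sine
      would vanish.\<close>
    then have "\<bar>h (\<i> * of_real R) + pi / 2\<bar> < pi / 2"
    proof (intro IVT_abs_less[of \<omega> R "\<lambda>t. h (\<i> * of_real t) + pi / 2"])
      show "continuous_on {\<omega>..R} (\<lambda>t. h (\<i> * of_real t) + pi / 2)"
        using \<omega> by (intro continuous_intros continuous_on_subset[OF ci]) auto
      show "\<bar>h (\<i> * of_real t) + pi / 2\<bar> \<noteq> pi / 2" if "\<omega> \<le> t" "t \<le> R" for t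
      proof
        assume "\<bar>h (\<i> * of_real t) + pi / 2\<bar> = pi / 2"
        then have "h (\<i> * of_real t) = 0 \<or> h (\<i> * of_real t) = - pi" by linarith
        then show False using neg[of t] \<omega> that by auto
      qed
    qed (use ab \<omega> in linarith)+
    then show ?thesis by linarith
  qed
  moreover have "h (\<i> * of_real R) > \<sigma> * (pi / 2) - pi / 2"
  proof -
    \<comment> \<open>\<open>H\<close> is the argument of Q s / s powr \<sigma> along the arc. By
      \<open>arc(2)\<close>, Q s rotated by - \<sigma> t lies in the open disc of radius R powr
      \<sigma> about R powr \<sigma>, hence in the right half-plane, so \<open>H\<close> starts at 0
      and never reaches pi / 2 or - pi / 2.\<close>
    define H where "H t = h (of_real R * cis t) - \<sigma> * t" for t
    have inS: "of_real R * cis t \<in> S" if "0 \<le> t" "t \<le> pi / 2" for t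
      using that arc(1) by (auto simp: S_def cos_ge_zero sin_ge_zero)
    have cosH: "cos (H t) > 0" if t: "0 \<le> t" "t \<le> pi / 2" for t
    proof -
      define s where "s = of_real R * cis t"
      have s: "cmod s = R" "s \<in> S" using arc(1) inS[OF t] by (auto simp: s_def norm_mult)
      have "s = exp (of_real (ln R) + \<i> * of_real t)"
        using arc(1) by (simp add: s_def exp_add cis_conv_exp exp_of_real)
      moreover have "- pi < t" "t \<le> pi" using t pi_gt_zero by linarith+
      ultimately have "Ln s = of_real (ln R) + \<i> * of_real t"
        by (simp add: Ln_exp)
      then have "s powr of_real \<sigma> = exp (of_real \<sigma> * (of_real (ln R) + \<i> * of_real t))"
        using arc(1) s(1) by (auto simp: powr_def)
      also have "\<dots> = of_real (R powr \<sigma>) * cis (\<sigma> * t)"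
        using arc(1) by (simp add: distrib_left exp_add powr_def cis_conv_exp exp_of_real[symmetric] mult_ac)
      finally have pw: "s powr of_real \<sigma> = of_real (R powr \<sigma>) * cis (\<sigma> * t)" .
      have "Q s * cis (- (\<sigma> * t)) - of_real (R powr \<sigma>) = (Q s - s powr of_real \<sigma>) * cis (- (\<sigma> * t))"
        unfolding pw by (simp add: left_diff_distrib mult.assoc cis_mult)
      then have "cmod (Q s * cis (- (\<sigma> * t)) - of_real (R powr \<sigma>)) < R powr \<sigma>"
        using arc(2)[OF s(1)] by (simp add: norm_mult)
      then have "\<bar>Re (Q s * cis (- (\<sigma> * t)) - of_real (R powr \<sigma>))\<bar> < R powr \<sigma>"
        by (rule le_less_trans[OF abs_Re_le_cmod])
      then have "Re (Q s * cis (- (\<sigma> * t))) > 0" by simp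
      moreover have "Q s * cis (- (\<sigma> * t)) = of_real (exp (Re (g s))) * cis (H t)"
      proof -
        have "exp (g s) = of_real (exp (Re (g s))) * cis (h s)"
          by (simp add: exp_eq_polar h_def)
        then show ?thesis
          using Qg[OF s(2)] by (simp add: mult.assoc cis_mult H_def s_def)
      qed
      ultimately show ?thesis by (simp add: zero_less_mult_iff)
    qed
    have "\<bar>H (pi / 2)\<bar> < pi / 2"
    proof (rule IVT_abs_less[of 0 "pi / 2" H])
      have "continuous_on {0..pi / 2} (\<lambda>t. h (of_real R * cis t))"
        by (rule continuous_on_compose2[OF h]) (auto intro!: continuous_intros inS)
      then show "continuous_on {0..pi / 2} H"
        unfolding H_def by (intro continuous_intros)
      show "\<bar>H t\<bar> \<noteq> pi / 2" if "0 \<le> t" "t \<le> pi / 2" for t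
      proof
        assume "\<bar>H t\<bar> = pi / 2"
        then have "H t = pi / 2 \<or> H t = - (pi / 2)" by linarith
        moreover have "cos (pi / 2) = 0" "cos (- (pi / 2)) = 0" by simp_all
        ultimately show False using cosH[OF that] by (metis less_irrefl)
      qed
    qed (use hR in \<open>auto simp: H_def\<close>)
    moreover have "H (pi / 2) = h (\<i> * of_real R) - \<sigma> * (pi / 2)"
      unfolding H_def cis_pi_half by (simp add: mult.commute)
    ultimately show ?thesis by linarith
  qed
  \<comment> \<open>For \<sigma> \<ge> 2 the arc estimate puts \<open>h\<close> above pi / 2 at \<i>
    R, against its negative value found along the imaginary half-line.\<close>
  moreover have "\<sigma> * (pi / 2) \<ge> 2 * (pi / 2)"
    by (rule mult_right_mono[OF \<sigma>]) simp
  ultimately show False using pi_gt_zero by linarith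
qed

text \<open>On the imaginary half-line the angles decide the signs: \<sigma> pi / 2 lies between pi
  and 3 pi / 2, where the sine is nonpositive, while each \<psi> k pi / 2 lies strictly between 0
  and pi. Hence Im Q \<le> 0 there, and the term with c k0 > 0 makes it strict.\<close>

lemma quasi_polynomial_zero:
  fixes c \<psi> :: "nat \<Rightarrow> real" and \<sigma> d :: real
  assumes d: "d > 0" and \<sigma>: "2 \<le> \<sigma>" "\<sigma> \<le> 3"
    and c: "\<And>k. k \<in> K \<Longrightarrow> c k \<ge> 0" "k0 \<in> K" "c k0 > 0" and K: "finite K"
    and \<psi>: "\<And>k. k \<in> K \<Longrightarrow> 0 < \<psi> k \<and> \<psi> k < 2"
  shows "\<exists>s. 0 < Re s \<and> s powr of_real \<sigma> - (\<Sum>k\<in>K. of_real (c k) * s powr of_real (\<psi> k)) + of_real d = 0"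
proof -
  define Q where "Q s = s powr of_real \<sigma> - (\<Sum>k\<in>K. of_real (c k) * s powr of_real (\<psi> k)) + of_real d" for s :: complex
  \<comment> \<open>The lower-order terms divided by R powr \<sigma>. They tend to 0 because \<psi>
    k < 2 \<le> \<sigma>, and any R where they sum to less than 1 serves as radius of the
    arc.\<close>
  have "((\<lambda>R. (\<Sum>k\<in>K. c k * R powr (- (\<sigma> - \<psi> k))) + d * R powr (- \<sigma>)) \<longlongrightarrow> (\<Sum>k\<in>K. c k * 0) + d * 0) at_top"
    using \<sigma> \<psi> by (intro tendsto_intros tendsto_neg_powr filterlim_ident) force+
  then have "\<forall>\<^sub>F R in at_top. (\<Sum>k\<in>K. c k * R powr (- (\<sigma> - \<psi> k))) + d * R powr (- \<sigma>) < 1"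
    by (rule order_tendstoD) simp
  then have "\<forall>\<^sub>F R in at_top. R > 0 \<and> (\<Sum>k\<in>K. c k * R powr (- (\<sigma> - \<psi> k))) + d * R powr (- \<sigma>) < 1"
    using eventually_gt_at_top[of 0] by eventually_elim auto
  then obtain R where R: "R > 0" "(\<Sum>k\<in>K. c k * R powr (- (\<sigma> - \<psi> k))) + d * R powr (- \<sigma>) < 1"
    using eventually_happens[of _ "at_top :: real filter"] by auto
  have "((\<Sum>k\<in>K. c k * R powr (- (\<sigma> - \<psi> k))) + d * R powr (- \<sigma>)) * R powr \<sigma> < 1 * R powr \<sigma>"
    using R by (intro mult_strict_right_mono) auto
  then have dom: "(\<Sum>k\<in>K. c k * R powr \<psi> k) + d < R powr \<sigma>"
    using R(1) by (simp add: distrib_right sum_distrib_right mult.assoc powr_add[symmetric])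
  have Ipow: "(\<i> * of_real r) powr of_real p = of_real (r powr p) * cis (p * pi / 2)" if "r > 0" for r p :: real
  proof -
    have "Ln (\<i> * of_real r) = of_real (ln r) + \<i> * of_real pi / 2"
      using that by (subst mult.commute) (simp add: Ln_times_of_real Ln_of_real)
    then show ?thesis
      using that by (simp add: powr_def exp_add distrib_left cis_conv_exp exp_of_real[symmetric] mult_ac)
  qed
  have "\<exists>s. 0 < Re s \<and> Q s = 0"
  proof (rule half_plane_zero_of_quadrant_winding[OF _ _ d _ _ \<sigma>(1) R(1)])
    show "continuous_on {z. 0 \<le> Re z \<and> 0 \<le> Im z} Q"
      unfolding Q_def using \<sigma> \<psi> by (intro continuous_intros) auto
    show "Q 0 = of_real d" by (simp add: Q_def)
    show "Im (Q (of_real r)) = 0" if "0 < r" for r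
      using that by (simp add: Q_def powr_of_real)
    show "Im (Q (\<i> * of_real r)) < 0" if r: "0 < r" for r
    proof -
      have "Im (Q (\<i> * of_real r)) = r powr \<sigma> * sin (\<sigma> * pi / 2) - (\<Sum>k\<in>K. c k * (r powr \<psi> k * sin (\<psi> k * pi / 2)))"
        unfolding Q_def Ipow[OF r] by simp
      moreover have "r powr \<sigma> * sin (\<sigma> * pi / 2) \<le> 0"
      proof -
        have "sin (\<sigma> * pi / 2 - pi) \<ge> 0"
          using \<sigma> by (intro sin_ge_zero) (auto simp: field_simps)
        then have "sin (\<sigma> * pi / 2) \<le> 0" by (simp add: sin_diff)
        then show ?thesis by (simp add: mult_nonneg_nonpos)
      qed
      moreover have "(\<Sum>k\<in>K. c k * (r powr \<psi> k * sin (\<psi> k * pi / 2))) > 0"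
      proof -
        have "sin (\<psi> k * pi / 2) > 0" if "k \<in> K" for k
          using \<psi>[OF that] by (intro sin_gt_zero) auto
        then show ?thesis
          using c r by (intro sum_pos2[OF K c(2)]) (auto simp: less_imp_le)
      qed
      ultimately show ?thesis by linarith
    qed
    show "cmod (Q s - s powr of_real \<sigma>) < R powr \<sigma>" if s: "cmod s = R" for s
    proof -
      have n: "cmod (s powr of_real p) = R powr p" for p :: real
        using s R(1) by (auto simp: norm_powr_real_powr')
      have "Q s - s powr of_real \<sigma> = of_real d - (\<Sum>k\<in>K. of_real (c k) * s powr of_real (\<psi> k))"
        by (simp add: Q_def)
      also have "cmod \<dots> \<le> cmod (of_real d) + cmod (\<Sum>k\<in>K. of_real (c k) * s powr of_real (\<psi> k))"
        by (rule norm_triangle_ineq4)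
      also have "\<dots> \<le> d + (\<Sum>k\<in>K. c k * R powr \<psi> k)"
        using d c by (intro add_mono sum_norm_le) (auto simp: norm_mult n)
      finally show ?thesis using dom by simp
    qed
  qed
  then show ?thesis by (simp add: Q_def)
qed

section \<open>Positive real zeros when det A > 0\<close>

lemma caputo_charfun_of_real:
  fixes \<alpha> :: "real ^ 3" and A :: "real ^ 3 ^ 3"
  assumes "0 \<le> r"
  shows "caputo_charfun \<alpha> A (of_real r) = of_real (det (\<chi> i j. (if i = j then r powr (\<alpha> $ i) else 0) - A $ i $ j))"
proof -
  define E where "E i j = (if i = j then r powr (\<alpha> $ i) else 0) - A $ i $ j" for i j
  have "(if i = j then of_real r powr of_real (\<alpha> $ i) else 0) - of_real (A $ i $ j) = complex_of_real (E i j)" for i j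
    using assms by (simp add: E_def powr_of_real)
  then have "caputo_charfun \<alpha> A (of_real r) = det (\<chi> i j. complex_of_real (E i j))"
    by (simp only: caputo_charfun_def)
  also have "\<dots> = of_real (det (\<chi> i j. E i j))"
    by (simp only: det_3 vec_lambda_beta of_real_add of_real_diff of_real_mult)
  finally show ?thesis by (simp only: E_def)
qed

text \<open>The value at 0 is det (- A) = - det A < 0, the dimension being odd, and for large real
  arguments the diagonal powers dominate.\<close>

lemma caputo_charfun_zero_of_det_pos:
  fixes \<alpha> :: "real ^ 3" and A :: "real ^ 3 ^ 3"
  assumes \<alpha>: "\<And>i. 0 < \<alpha> $ i" and A: "det A > 0"
  shows "\<exists>r>0. caputo_charfun \<alpha> A (of_real r) = 0"
proof -
  define q where "q r = det (\<chi> i j. (if i = j then r powr (\<alpha> $ i) else 0) - A $ i $ j)" for r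
  \<comment> \<open>Row i is divided by its diagonal power; the remaining matrix tends to the
    identity, so \<open>B\<close> tends to 1.\<close>
  define B where "B r = det (\<chi> i j. (if i = j then 1 else 0) - r powr (- \<alpha> $ i) * A $ i $ j)" for r
  have qB: "q r = r powr (\<alpha> $ 1) * r powr (\<alpha> $ 2) * r powr (\<alpha> $ 3) * B r" if "r > 0" for r
    unfolding q_def B_def det_3 using that by (simp add: powr_minus field_simps)
  have "((\<lambda>r. r powr (- \<alpha> $ i)) \<longlongrightarrow> 0) at_top" for i
    by (intro tendsto_neg_powr filterlim_ident) (simp add: \<alpha>)
  note lim = this[of 1] this[of 2] this[of 3]
  have "(B \<longlongrightarrow> det (\<chi> i j. (if i = j then 1 else 0) - 0 * A $ i $ j)) at_top"
    unfolding B_def det_3 vec_lambda_beta by (intro tendsto_intros lim)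
  then have "(B \<longlongrightarrow> 1) at_top" by (simp add: det_3)
  then have "\<forall>\<^sub>F r in at_top. B r > 0" by (rule order_tendstoD) simp
  then have "\<forall>\<^sub>F r in at_top. r > 0 \<and> B r > 0"
    using eventually_gt_at_top[of 0] by eventually_elim auto
  then obtain R where R: "R > 0" "B R > 0"
    using eventually_happens[of _ "at_top :: real filter"] by auto
  have "q R > 0" using R qB by simp
  moreover have "q 0 < 0"
  proof -
    have "q 0 = - det A" by (simp add: q_def det_3)
    then show ?thesis using A by simp
  qed
  moreover have "continuous_on {0..R} q"
  proof -
    define E where "E i j r = (if i = j then r powr (\<alpha> $ i) else 0) - A $ i $ j" for i j r
    have E: "continuous_on {0..R} (E i j)" for i j
      unfolding E_def using \<alpha>[of i] by (cases "i = j") (auto intro!: continuous_intros continuous_on_powr')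
    have "q = (\<lambda>r. det (\<chi> i j. E i j r))"
      by (simp add: q_def E_def fun_eq_iff)
    then show ?thesis
      unfolding det_3 vec_lambda_beta by (simp only:) (intro continuous_intros E)
  qed
  ultimately obtain r where r: "0 \<le> r" "q r = 0"
    using IVT'[of q 0 0 R] R by force
  then have "r > 0" using \<open>q 0 < 0\<close> by (cases "r = 0") auto
  then show ?thesis using r caputo_charfun_of_real[of r \<alpha> A] by (auto simp: q_def)
qed

theorem theorem2:
  fixes \<alpha> :: "real ^ 3" and A :: "real ^ 3 ^ 3"
  assumes "\<And>i. 0 < \<alpha> $ i \<and> \<alpha> $ i \<le> 1"
  shows "(det A > 0 \<longrightarrow> caputo_unstable \<alpha> A) \<and>
    (det A < 0 \<and> \<alpha> $ 1 + \<alpha> $ 2 + \<alpha> $ 3 \<ge> 2 \<and>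
      (\<exists>(n::nat) (c :: nat \<Rightarrow> real) (\<psi> :: nat \<Rightarrow> real).
         n \<ge> 1 \<and>
         Max (c ` {1..n}) > Min (c ` {1..n}) \<and> Min (c ` {1..n}) \<ge> 0 \<and>
         (\<forall>k\<in>{1..n}. 0 < \<psi> k \<and> \<psi> k < 2) \<and>
         (\<forall>s::complex. caputo_charfun \<alpha> A s =
            s powr of_real (\<alpha> $ 1 + \<alpha> $ 2 + \<alpha> $ 3)
            - (\<Sum>k=1..n. of_real (c k) * s powr of_real (\<psi> k))
            - of_real (det A)))
      \<longrightarrow> caputo_unstable \<alpha> A)"
proof -
  have unstable: "caputo_unstable \<alpha> A" if "0 < Re s" "caputo_charfun \<alpha> A s = 0" for s
    using stable_imp_charfun_nonzero[OF assms _ that(1)] that(2) unfolding caputo_unstable_def by blast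
  show ?thesis
  proof (intro conjI impI, goal_cases)
    case 1
    then obtain r where "r > 0" "caputo_charfun \<alpha> A (of_real r) = 0"
      using caputo_charfun_zero_of_det_pos[of \<alpha> A] assms by blast
    then show ?case by (intro unstable[of "of_real r"]) auto
  next
    case 2
    then show ?case
    proof (elim conjE exE, goal_cases)
      case (1 n c \<psi>)
      note A = 1(1) and \<sigma> = 1(2) and n = 1(3) and Max = 1(4) and Min = 1(5) and \<psi> = 1(6) and Q = 1(7)
      \<comment> \<open>The maximum is attained because n \<ge> 1, and it exceeds a nonnegative
        minimum; its index gives the strictly positive coefficient.\<close>
      have "Max (c ` {1..n}) \<in> c ` {1..n}"
        using n by (intro Max_in) auto
      then obtain k0 where k0: "k0 \<in> {1..n}" "c k0 = Max (c ` {1..n})" by auto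
      have "c k \<ge> 0" if "k \<in> {1..n}" for k
        using Min_le[of "c ` {1..n}" "c k"] that Min by auto
      moreover have "c k0 > 0" using k0 Max Min by linarith
      \<comment> \<open>With the lower bound 2 this confines the angle of the leading term on the
        imaginary half-line to the third quadrant.\<close>
      moreover have "\<alpha> $ 1 + \<alpha> $ 2 + \<alpha> $ 3 \<le> 3"
        using assms[of 1] assms[of 2] assms[of 3] by linarith
      ultimately have "\<exists>s. 0 < Re s \<and> s powr of_real (\<alpha> $ 1 + \<alpha> $ 2 + \<alpha> $ 3)
              - (\<Sum>k=1..n. of_real (c k) * s powr of_real (\<psi> k)) + of_real (- det A) = 0"
        using A \<sigma> k0(1) \<psi> by (intro quasi_polynomial_zero) auto
      then obtain s where "0 < Re s"
        "s powr of_real (\<alpha> $ 1 + \<alpha> $ 2 + \<alpha> $ 3)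
              - (\<Sum>k=1..n. of_real (c k) * s powr of_real (\<psi> k)) + of_real (- det A) = 0"
        by blast
      then show ?case using Q by (intro unstable[of s]) auto
    qed
  qed
qed

end
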